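(* Let $(G,c)$ be a network, let $\Delta_{\ell^2}$ be the self-adjoint Laplace operator on $\ell^2(G)$, and let $\Delta_{\mathcal H_{\mathcal E}}^{(Kr)}=JJ^\star$ be the Krein extension of the Laplace operator on $\mathcal H_{\mathcal E}$, where $J$ is the closure of the inclusion operator $\operatorname{span}\{\delta_x\}_{x\in G}\subseteq\ell^2(G)\to\mathcal H_{\mathcal E}$, $\delta_x\mapsto\delta_x$. Then $$\operatorname{spec}_{\mathcal H_{\mathcal E}}\bigl(\Delta_{\mathcal H_{\mathcal E}}^{(Kr)}\bigr)\cup\{0\}=\operatorname{spec}_{\ell^2}(\Delta_{\ell^2})\cup\{0\}.$$
   Context: A network $(G,c)$ is a connected weighted undirected graph with vertex set $G$, given by a symmetric function $c:G\times G\to[0,\infty)$, $(x,y)\mapsto c_{xy}=c_{yx}$, with $c_{xx}=0$; write $x\sim y$ iff $c_{xy}>0$. It is locally finite (each $x$ has only finitely many $y$ with $y\sim x$) and connected (any two vertices are joined by a finite path of edges with positive conductance). The Laplacian acts on functions by $(\Delta u)(x)=\sum_{y\sim x}c_{xy}(u(x)-u(y))$. The energy form is $\mathcal E(u,v)=\frac12\sum_{x,y\in G}c_{xy}(u(x)-u(y))(v(x)-v(y))$ on $\operatorname{dom}\mathcal E=\{u:\mathcal E(u,u)<\infty\}$. The energy space $\mathcal H_{\mathcal E}:=\operatorname{dom}\mathcal E/\mathbb R\mathbf 1$ (functions of finite energy modulo constants) is a Hilbert space with inner product $\langle u,v\rangle_{\mathcal H_{\mathcal E}}=\mathcal E(u,v)$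 (for complex-valued functions, modulo $\mathbb C\mathbf 1$ and with $\mathcal E(\bar u,v)$). $\ell^2(G)$ is the space of square-summable functions on $G$ (counting measure), with $\langle u,v\rangle_{\ell^2}=\sum_x u(x)v(x)$ (conjugate on $u$ in the complex case). $\delta_x$ denotes both the characteristic function of $\{x\}$ in $\ell^2(G)$ and the element of $\mathcal H_{\mathcal E}$ it represents (it has finite energy). $\Delta_{\ell^2}$ is the graph closure in $\ell^2(G)$ of $\Delta$ on $\operatorname{span}\{\delta_x\}_{x\in G}$; it is self-adjoint. The inclusion operator is densely defined and closable. $\Delta_{\mathcal H_{\mathcal E}}^{(Kr)}$ denotes the self-adjoint operator $JJ^\star$ on $\mathcal H_{\mathcal E}$, which is identified in the paper as the Krein extension of the Laplacian on $\mathcal H_{\mathcal E}$. $\operatorname{spec}$ denotes the spectrum in the indicated Hilbert space. *)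

theory Defs
  imports "HOL-Analysis.Analysis" "HOL-Library.Function_Algebras"
begin

section \<open>Scalars\<close>

text \<open>
  The common interface of the two scalar fields \<open>\<real>\<close> (with trivial conjugation) and \<open>\<complex>\<close> (with
  complex conjugation), so that real and complex function spaces are treated at the same time.
\<close>

class conj_scalar = real_normed_field + banach +
  fixes conj :: "'a \<Rightarrow> 'a"
  assumes conj_add: "conj (a + b) = conj a + conj b"
    and conj_mult: "conj (a * b) = conj a * conj b"
    and conj_conj: "conj (conj a) = a"
    and conj_mult_self: "conj a * a = (norm a)\<^sup>2 *\<^sub>R 1"

instantiation real :: conj_scalar
begin
definition conj_real :: "real \<Rightarrow> real" where "conj_real a = a"
instance by standard (auto simp: conj_real_def power2_eq_square)
end

instantiation complex :: conj_scalar
begin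
definition conj_complex :: "complex \<Rightarrow> complex" where "conj_complex a = cnj a"
instance
proof
  fix a :: complex
  show "conj a * a = (norm a)\<^sup>2 *\<^sub>R 1"
    using complex_norm_square[of a]
    by (simp add: conj_complex_def scaleR_conv_of_real mult.commute)
qed (auto simp: conj_complex_def)
end

section \<open>Inner product spaces and unbounded operators\<close>

text \<open>
  The energy space depends on the conductance function, hence spaces have explicit carriers. Inner
  products are conjugate linear in the first argument.
\<close>

record ('k, 'a) inner_space =
  vecs :: "'a set"
  vadd :: "'a \<Rightarrow> 'a \<Rightarrow> 'a"
  vscale :: "'k \<Rightarrow> 'a \<Rightarrow> 'a"
  vinner :: "'a \<Rightarrow> 'a \<Rightarrow> 'k"

definition vdiff :: "('k::conj_scalar, 'a) inner_space \<Rightarrow> 'a \<Rightarrow> 'a \<Rightarrow> 'a" where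
  "vdiff H x y = vadd H x (vscale H (- 1) y)"

definition vnorm :: "('k::conj_scalar, 'a) inner_space \<Rightarrow> 'a \<Rightarrow> real" where
  "vnorm H x = sqrt (norm (vinner H x x))"

definition vconverges :: "('k::conj_scalar, 'a) inner_space \<Rightarrow> (nat \<Rightarrow> 'a) \<Rightarrow> 'a \<Rightarrow> bool" where
  "vconverges H X x \<longleftrightarrow> (\<lambda>n. vnorm H (vdiff H (X n) x)) \<longlonglongrightarrow> 0"

text \<open>
  A (partially defined) operator is given by its graph. The operator \<open>S\<close> after \<open>T\<close> is thus the
  relational composition \<open>T O S\<close>, whose domain is \<open>{x \<in> dom T. T x \<in> dom S}\<close>.
\<close>

type_synonym ('a, 'b) operator = "('a \<times> 'b) set"

definition op_closure ::
  "('k::conj_scalar, 'a) inner_space \<Rightarrow> ('k, 'b) inner_space \<Rightarrow> ('a, 'b) operator \<Rightarrow> ('a, 'b) operator"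
  where
  "op_closure H K T =
     {(x, y). x \<in> vecs H \<and> y \<in> vecs K \<and>
        (\<exists>X Y. (\<forall>n. (X n, Y n) \<in> T) \<and> vconverges H X x \<and> vconverges K Y y)}"

definition op_adjoint ::
  "('k::conj_scalar, 'a) inner_space \<Rightarrow> ('k, 'b) inner_space \<Rightarrow> ('a, 'b) operator \<Rightarrow> ('b, 'a) operator"
  where
  "op_adjoint H K T =
     {(y, z). y \<in> vecs K \<and> z \<in> vecs H \<and> (\<forall>(x, w) \<in> T. vinner K y w = vinner H z x)}"

text \<open>\<open>T - \<mu>\<close> maps \<open>dom T\<close> bijectively onto the space and its inverse is bounded.\<close>

definition resolvent_set ::
  "('k::conj_scalar, 'a) inner_space \<Rightarrow> ('a, 'a) operator \<Rightarrow> 'k set" where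
  "resolvent_set H T =
     {\<mu>. (\<forall>z \<in> vecs H. \<exists>!p. p \<in> T \<and> vdiff H (snd p) (vscale H \<mu> (fst p)) = z) \<and>
         (\<exists>C. \<forall>(x, y) \<in> T. vnorm H x \<le> C * vnorm H (vdiff H y (vscale H \<mu> x)))}"

definition spectrum ::
  "('k::conj_scalar, 'a) inner_space \<Rightarrow> ('a, 'a) operator \<Rightarrow> 'k set" where
  "spectrum H T = - resolvent_set H T"

section \<open>Networks\<close>

text \<open>The vertex set \<open>G\<close> is the type \<open>'v\<close>.\<close>

locale network =
  fixes c :: "'v \<Rightarrow> 'v \<Rightarrow> real"
  assumes conductance_nonneg: "c x y \<ge> 0"
    and conductance_sym: "c x y = c y x"
    and conductance_refl: "c x x = 0"
    and locally_finite: "finite {y. c x y > 0}"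
    and connected: "(x, y) \<in> {(x, y). c x y > 0}\<^sup>*"

definition laplacian :: "('v \<Rightarrow> 'v \<Rightarrow> real) \<Rightarrow> ('v \<Rightarrow> 'k::conj_scalar) \<Rightarrow> 'v \<Rightarrow> 'k" where
  "laplacian c u x = (\<Sum>y | c x y > 0. of_real (c x y) * (u x - u y))"

definition delta :: "'v \<Rightarrow> 'v \<Rightarrow> 'k::conj_scalar" where
  "delta x y = (if y = x then 1 else 0)"

definition delta_span :: "('v \<Rightarrow> 'k::conj_scalar) set" where
  "delta_span = module.span (\<lambda>a u x. a * u x) (range delta)"

subsection \<open>Square-summable functions\<close>

definition l2_space :: "('k::conj_scalar, 'v \<Rightarrow> 'k) inner_space" where
  "l2_space =
     \<lparr>vecs = {u. (\<lambda>x. (norm (u x))\<^sup>2) summable_on UNIV},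
      vadd = (\<lambda>u v x. u x + v x),
      vscale = (\<lambda>a u x. a * u x),
      vinner = (\<lambda>u v. \<Sum>\<^sub>\<infinity>x. conj (u x) * v x)\<rparr>"

definition l2_laplacian ::
  "('v \<Rightarrow> 'v \<Rightarrow> real) \<Rightarrow> ('v \<Rightarrow> 'k::conj_scalar, 'v \<Rightarrow> 'k) operator" where
  "l2_laplacian c = op_closure l2_space l2_space {(u, laplacian c u) | u. u \<in> delta_span}"

subsection \<open>The energy space\<close>

definition dom_energy :: "('v \<Rightarrow> 'v \<Rightarrow> real) \<Rightarrow> ('v \<Rightarrow> 'k::conj_scalar) set" where
  "dom_energy c = {u. (\<lambda>(x, y). c x y * (norm (u x - u y))\<^sup>2) summable_on UNIV}"

definition energy ::
  "('v \<Rightarrow> 'v \<Rightarrow> real) \<Rightarrow> ('v \<Rightarrow> 'k::conj_scalar) \<Rightarrow> ('v \<Rightarrow> 'k) \<Rightarrow> 'k" where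
  "energy c u v =
     (\<Sum>\<^sub>\<infinity>(x, y). of_real (c x y) * (conj (u x - u y) * (v x - v y))) / 2"

definition const_rel ::
  "('v \<Rightarrow> 'v \<Rightarrow> real) \<Rightarrow> (('v \<Rightarrow> 'k::conj_scalar) \<times> ('v \<Rightarrow> 'k)) set" where
  "const_rel c = {(u, v). u \<in> dom_energy c \<and> v \<in> dom_energy c \<and> (\<exists>a. \<forall>x. v x = u x + a)}"

definition energy_class ::
  "('v \<Rightarrow> 'v \<Rightarrow> real) \<Rightarrow> ('v \<Rightarrow> 'k::conj_scalar) \<Rightarrow> ('v \<Rightarrow> 'k) set" where
  "energy_class c u = const_rel c `` {u}"

definition rep :: "('v \<Rightarrow> 'k) set \<Rightarrow> 'v \<Rightarrow> 'k" where
  "rep A = (SOME u. u \<in> A)"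

definition energy_space ::
  "('v \<Rightarrow> 'v \<Rightarrow> real) \<Rightarrow> ('k::conj_scalar, ('v \<Rightarrow> 'k) set) inner_space" where
  "energy_space c =
     \<lparr>vecs = dom_energy c // const_rel c,
      vadd = (\<lambda>A B. energy_class c (\<lambda>x. rep A x + rep B x)),
      vscale = (\<lambda>a A. energy_class c (\<lambda>x. a * rep A x)),
      vinner = (\<lambda>A B. energy c (rep A) (rep B))\<rparr>"

subsection \<open>The inclusion operator and the Krein extension\<close>

definition inclusion ::
  "('v \<Rightarrow> 'v \<Rightarrow> real) \<Rightarrow> ('v \<Rightarrow> 'k::conj_scalar, ('v \<Rightarrow> 'k) set) operator" where
  "inclusion c = op_closure l2_space (energy_space c) {(u, energy_class c u) | u. u \<in> delta_span}"

definition krein_laplacian ::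
  "('v \<Rightarrow> 'v \<Rightarrow> real) \<Rightarrow> (('v \<Rightarrow> 'k::conj_scalar) set, ('v \<Rightarrow> 'k) set) operator" where
  "krein_laplacian c = op_adjoint l2_space (energy_space c) (inclusion c) O inclusion c"

subsection \<open>The operations of the energy space do not depend on the representatives\<close>

lemma equiv_const_rel: "equiv (dom_energy c) (const_rel c)"
proof (rule equivI)
  show "const_rel c \<subseteq> dom_energy c \<times> dom_energy c"
    by (auto simp: const_rel_def)
  show "refl_on (dom_energy c) (const_rel c)"
    by (auto simp: refl_on_def const_rel_def intro!: exI[of _ 0])
  show "sym (const_rel c)"
  proof (rule symI)
    fix u v assume "(u, v) \<in> const_rel c"
    then obtain a where "u \<in> dom_energy c" "v \<in> dom_energy c" "\<And>x. v x = u x + a"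
      by (auto simp: const_rel_def)
    then show "(v, u) \<in> const_rel c"
      by (auto simp: const_rel_def intro!: exI[of _ "- a"])
  qed
  show "trans (const_rel c)"
  proof (rule transI)
    fix u v w assume "(u, v) \<in> const_rel c" "(v, w) \<in> const_rel c"
    then obtain a b where "u \<in> dom_energy c" "w \<in> dom_energy c"
      "\<And>x. v x = u x + a" "\<And>x. w x = v x + b"
      by (auto simp: const_rel_def)
    then show "(u, w) \<in> const_rel c"
      by (auto simp: const_rel_def intro!: exI[of _ "a + b"])
  qed
qed

lemma rep_energy_class:
  assumes "u \<in> dom_energy c"
  shows "(u, rep (energy_class c u)) \<in> const_rel c"
proof -
  have "u \<in> energy_class c u"
    using equiv_class_self[OF equiv_const_rel assms] by (simp add: energy_class_def)
  then have "rep (energy_class c u) \<in> energy_class c u"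
    unfolding rep_def by (rule someI[where P = "\<lambda>v. v \<in> energy_class c u"])
  then show ?thesis by (simp add: energy_class_def)
qed

lemma vinner_energy_class:
  assumes "u \<in> dom_energy c" "v \<in> dom_energy c"
  shows "vinner (energy_space c) (energy_class c u) (energy_class c v) = energy c u v"
proof -
  obtain a b where "\<And>x. rep (energy_class c u) x = u x + a" "\<And>x. rep (energy_class c v) x = v x + b"
    using rep_energy_class[OF assms(1)] rep_energy_class[OF assms(2)]
    by (auto simp: const_rel_def)
  then show ?thesis by (simp add: energy_space_def energy_def)
qed

lemma energy_class_add_const: "energy_class c (\<lambda>x. u x + a) = energy_class c u"
proof -
  have "(\<lambda>x. u x + a) \<in> dom_energy c \<longleftrightarrow> u \<in> dom_energy c"
    by (simp add: dom_energy_def)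
  moreover have "(\<exists>b. \<forall>x. v x = u x + a + b) \<longleftrightarrow> (\<exists>b. \<forall>x. v x = u x + b)" for v
  proof
    assume "\<exists>b. \<forall>x. v x = u x + b"
    then obtain b where "\<forall>x. v x = u x + b" by blast
    then have "\<forall>x. v x = u x + a + (b - a)" by simp
    then show "\<exists>b. \<forall>x. v x = u x + a + b" by blast
  qed (auto simp: add.assoc)
  ultimately show ?thesis by (auto simp: energy_class_def const_rel_def)
qed

lemma vadd_energy_class:
  assumes "u \<in> dom_energy c" "v \<in> dom_energy c"
  shows "vadd (energy_space c) (energy_class c u) (energy_class c v) =
    energy_class c (\<lambda>x. u x + v x)"
proof -
  obtain a b where "\<And>x. rep (energy_class c u) x = u x + a" "\<And>x. rep (energy_class c v) x = v x + b"
    using rep_energy_class[OF assms(1)] rep_energy_class[OF assms(2)]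
    by (auto simp: const_rel_def)
  then show ?thesis
    using energy_class_add_const[of c "\<lambda>x. u x + v x" "a + b"]
    by (simp add: energy_space_def algebra_simps)
qed

lemma vscale_energy_class:
  assumes "u \<in> dom_energy c"
  shows "vscale (energy_space c) r (energy_class c u) = energy_class c (\<lambda>x. r * u x)"
proof -
  obtain a where "\<And>x. rep (energy_class c u) x = u x + a"
    using rep_energy_class[OF assms] by (auto simp: const_rel_def)
  then show ?thesis
    using energy_class_add_const[of c "\<lambda>x. r * u x" "r * a"]
    by (simp add: energy_space_def algebra_simps)
qed

end

theory Submission
  imports Defs
begin

text \<open>
  Write \<open>J\<close> for the closed inclusion of \<open>\<ell>\<^sup>2\<close> into the energy space, so that the Krein extension is
  \<open>J J\<^sup>*\<close>. The statement follows from two facts.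

  The first is purely algebraic. If \<open>A\<close> and \<open>B\<close> are formally adjoint to each other and \<open>B A + 1\<close> is
  surjective, then every nonzero point of the resolvent set of \<open>A B\<close> belongs to the resolvent set of
  \<open>B A\<close> (\<open>resolvent_set_product_swap\<close>). It is used for the pairs \<open>(J, J\<^sup>*)\<close> and \<open>(J\<^sup>*, J)\<close>. The required
  surjectivity of \<open>J\<^sup>* J + 1\<close> and \<open>J J\<^sup>* + 1\<close> comes from the orthogonal projection onto the graph of
  \<open>J\<close>, as in the theorem of von Neumann (\<open>inclusion_graph_projection\<close>). Hence \<open>J J\<^sup>*\<close> and \<open>J\<^sup>* J\<close> have
  the same spectrum outside \<open>0\<close>.

  The second is the identity \<open>J\<^sup>* J = \<Delta>\<close> on \<open>\<ell>\<^sup>2\<close> (\<open>l2_laplacian_eq_inclusion_product\<close>). By the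
  Gauss--Green formula, \<open>J\<^sup>*\<close> sends the class of \<open>u\<close> to the function \<open>\<Delta> u\<close>, so \<open>J\<^sup>* J\<close> and the closure
  of \<open>\<Delta>\<close> on finitely supported functions are both restrictions of the pointwise Laplacian. Both become
  surjective after adding \<open>1\<close>, and the pointwise operator \<open>\<Delta> + 1\<close> is injective on \<open>\<ell>\<^sup>2\<close> by the maximum
  principle (\<open>laplacian_eq_minus_imp_zero\<close>); so they agree.

  The Hilbert space theory is done for square-summable functions on an arbitrary index set only. The
  energy space embeds isometrically into \<open>\<ell>\<^sup>2\<close> of the pairs of vertices by the weighted gradient, and the
  product of \<open>\<ell>\<^sup>2\<close> with it into \<open>\<ell>\<^sup>2\<close> of a disjoint sum. In this way the completeness of the energy space
  is not needed.
\<close>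

section \<open>Conjugation\<close>

lemma conj_of_real: "conj (of_real r) = (of_real r :: 'k::conj_scalar)"
proof (cases "r = 0")
  case True
  have "conj (0 + 0 :: 'k) = conj 0 + conj 0" by (rule conj_add)
  with True show ?thesis by simp
next
  case False
  have "conj (of_real r) * of_real r = (of_real r * of_real r :: 'k)"
    using conj_mult_self[of "of_real r :: 'k"] by (simp add: power2_eq_square scaleR_conv_of_real)
  with False show ?thesis by simp
qed

lemma conj_0 [simp]: "conj 0 = (0 :: 'k::conj_scalar)"
  using conj_of_real[of 0] by simp

lemma conj_1 [simp]: "conj 1 = (1 :: 'k::conj_scalar)"
  using conj_of_real[of 1] by simp

lemma conj_minus: "conj (- a) = - conj (a :: 'k::conj_scalar)"
  using conj_add[of a "- a"] by (simp add: eq_neg_iff_add_eq_0 add.commute)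

lemma conj_diff: "conj (a - b) = conj a - conj (b :: 'k::conj_scalar)"
  using conj_add[of a "- b"] by (simp add: conj_minus)

lemma conj_eq_iff [simp]: "conj a = conj b \<longleftrightarrow> a = (b :: 'k::conj_scalar)"
  by (metis conj_conj)

lemma norm_conj [simp]: "norm (conj a) = norm (a :: 'k::conj_scalar)"
proof (cases "a = 0")
  case False
  have "norm (conj a) * norm a = norm a * norm a"
    using arg_cong[OF conj_mult_self[of a], of norm]
    by (simp add: norm_mult power2_eq_square)
  with False show ?thesis by simp
qed simp

lemma conj_mult_self': "conj a * a = (of_real ((norm a)\<^sup>2) :: 'k::conj_scalar)"
  by (simp add: conj_mult_self scaleR_conv_of_real)

lemma bounded_linear_conj: "bounded_linear (conj :: 'k::conj_scalar \<Rightarrow> 'k)"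
  by (rule bounded_linear_intro[of _ 1])
     (simp_all add: conj_add scaleR_conv_of_real conj_mult conj_of_real)

lemma conj_sum: "conj (sum f A) = (\<Sum>x\<in>A. conj (f x) :: 'k::conj_scalar)"
  by (induction A rule: infinite_finite_induct) (simp_all add: conj_add)

section \<open>Square-summable functions\<close>

abbreviation l2 :: "('i \<Rightarrow> 'k::conj_scalar) set" where "l2 \<equiv> vecs l2_space"

abbreviation l2_inner :: "('i \<Rightarrow> 'k::conj_scalar) \<Rightarrow> ('i \<Rightarrow> 'k) \<Rightarrow> 'k"
  where "l2_inner \<equiv> vinner l2_space"

abbreviation l2_norm :: "('i \<Rightarrow> 'k::conj_scalar) \<Rightarrow> real"
  where "l2_norm \<equiv> vnorm l2_space"

lemma l2_iff: "u \<in> l2 \<longleftrightarrow> (\<lambda>x. (norm (u x))\<^sup>2) summable_on UNIV"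
  by (simp add: l2_space_def)

lemma l2_inner_def: "l2_inner u v = (\<Sum>\<^sub>\<infinity>x. conj (u x) * v x)"
  by (simp add: l2_space_def)

lemma vadd_l2 [simp]: "vadd l2_space u v = (\<lambda>x. u x + v x)"
  by (simp add: l2_space_def)

lemma vscale_l2 [simp]: "vscale l2_space a u = (\<lambda>x. a * u x)"
  by (simp add: l2_space_def)

lemma vdiff_l2 [simp]: "vdiff l2_space u v = (\<lambda>x. u x - v x)"
  by (simp add: vdiff_def)

lemma vconverges_l2: "vconverges l2_space X u \<longleftrightarrow> (\<lambda>n. l2_norm (\<lambda>x. X n x - u x)) \<longlonglongrightarrow> 0"
  by (simp add: vconverges_def)

lemma l2_inner_self_infsum:
  assumes "u \<in> l2" shows "l2_inner u u = of_real (\<Sum>\<^sub>\<infinity>x. (norm (u x))\<^sup>2)"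
proof -
  have "(\<Sum>\<^sub>\<infinity>x. conj (u x) * u x) = (\<Sum>\<^sub>\<infinity>x. (norm (u x))\<^sup>2 *\<^sub>R 1)"
    by (simp add: conj_mult_self)
  also have "\<dots> = (\<Sum>\<^sub>\<infinity>x. (norm (u x))\<^sup>2) *\<^sub>R 1"
    using assms by (intro infsum_scaleR_left) (simp add: l2_iff)
  finally show ?thesis
    by (simp add: l2_inner_def scaleR_conv_of_real)
qed

lemma l2_norm_eq: "u \<in> l2 \<Longrightarrow> l2_norm u = sqrt (\<Sum>\<^sub>\<infinity>x. (norm (u x))\<^sup>2)"
  by (simp add: vnorm_def l2_inner_self_infsum infsum_nonneg)

lemma l2_norm_nonneg [simp]: "0 \<le> l2_norm u"
  by (simp add: vnorm_def)

lemma power2_l2_norm: "u \<in> l2 \<Longrightarrow> (l2_norm u)\<^sup>2 = (\<Sum>\<^sub>\<infinity>x. (norm (u x))\<^sup>2)"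
  by (simp add: l2_norm_eq infsum_nonneg)

lemma L2_set_le_l2_norm:
  assumes "u \<in> l2" "finite F"
  shows "L2_set (\<lambda>x. norm (u x)) F \<le> l2_norm u"
  using assms by (simp add: L2_set_def l2_norm_eq l2_iff finite_sum_le_infsum)

lemma norm_le_l2_norm: "u \<in> l2 \<Longrightarrow> norm (u x) \<le> l2_norm u"
  using L2_set_le_l2_norm[of u "{x}"] by simp

text \<open>A uniform bound on the finite sections gives square-summability and a bound on the norm.\<close>

lemma l2_boundedI:
  assumes "\<And>F. finite F \<Longrightarrow> L2_set (\<lambda>x. norm (u x)) F \<le> B"
  shows "u \<in> l2" "l2_norm u \<le> B"
proof -
  have B: "0 \<le> B" using assms[of "{}"] by simp
  have sums: "(\<Sum>x\<in>F. (norm (u x))\<^sup>2) \<le> B\<^sup>2" if "finite F" for F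
    using assms[OF that] by (simp add: L2_set_def sqrt_le_D)
  then show l2: "u \<in> l2"
    unfolding l2_iff by (intro nonneg_bdd_above_summable_on) (auto intro!: bdd_aboveI)
  show "l2_norm u \<le> B"
    unfolding l2_norm_eq[OF l2] using l2 sums B
    by (intro real_le_lsqrt infsum_le_finite_sums) (auto simp: l2_iff infsum_nonneg)
qed

lemma l2_triangle:
  assumes "u \<in> l2" "v \<in> l2"
  shows "(\<lambda>x. u x + v x) \<in> l2" "l2_norm (\<lambda>x. u x + v x) \<le> l2_norm u + l2_norm v"
proof -
  have *: "L2_set (\<lambda>x. norm (u x + v x)) F \<le> l2_norm u + l2_norm v" if F: "finite F" for F
  proof -
    have "L2_set (\<lambda>x. norm (u x + v x)) F \<le> L2_set (\<lambda>x. norm (u x) + norm (v x)) F"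
      by (intro L2_set_mono norm_triangle_ineq) simp
    also have "\<dots> \<le> L2_set (\<lambda>x. norm (u x)) F + L2_set (\<lambda>x. norm (v x)) F"
      by (rule L2_set_triangle_ineq)
    also have "\<dots> \<le> l2_norm u + l2_norm v"
      by (intro add_mono L2_set_le_l2_norm assms F)
    finally show ?thesis .
  qed
  show "(\<lambda>x. u x + v x) \<in> l2" "l2_norm (\<lambda>x. u x + v x) \<le> l2_norm u + l2_norm v"
    using l2_boundedI[of "\<lambda>x. u x + v x", OF *] by auto
qed

lemma l2_scale: "u \<in> l2 \<Longrightarrow> (\<lambda>x. a * u x) \<in> l2"
  by (simp add: l2_iff norm_mult power_mult_distrib summable_on_cmult_right)

lemma l2_norm_scale: "l2_norm (\<lambda>x. a * u x) = norm a * l2_norm u"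
proof -
  have "l2_inner (\<lambda>x. a * u x) (\<lambda>x. a * u x) = (conj a * a) * l2_inner u u"
    unfolding l2_inner_def by (subst infsum_cmult_right'[symmetric]) (simp add: conj_mult mult_ac)
  then show ?thesis by (simp add: vnorm_def norm_mult real_sqrt_mult)
qed

lemma l2_norm_0 [simp]: "l2_norm (\<lambda>x. 0) = 0"
  using l2_norm_scale[of 0 "\<lambda>x. 0"] by simp

lemma l2_minus: "u \<in> l2 \<Longrightarrow> (\<lambda>x. - u x) \<in> l2"
  by (simp add: l2_iff)

lemma l2_norm_minus: "l2_norm (\<lambda>x. - u x) = l2_norm u"
  using l2_norm_scale[of "- 1" u] by simp

lemma l2_diff:
  assumes "u \<in> l2" "v \<in> l2" shows "(\<lambda>x. u x - v x) \<in> l2"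
  using l2_triangle(1)[OF assms(1) l2_minus[OF assms(2)]] by simp

lemma l2_norm_diff:
  assumes "u \<in> l2" "v \<in> l2" shows "l2_norm (\<lambda>x. u x - v x) \<le> l2_norm u + l2_norm v"
  using l2_triangle(2)[OF assms(1) l2_minus[OF assms(2)]] by (simp add: l2_norm_minus)

lemma l2_norm_diff_commute: "l2_norm (\<lambda>x. u x - v x) = l2_norm (\<lambda>x. v x - u x)"
  using l2_norm_minus[of "\<lambda>x. u x - v x"] by simp

lemma l2_norm_eq_0: "u \<in> l2 \<Longrightarrow> l2_norm u = 0 \<Longrightarrow> u x = 0"
  using norm_le_l2_norm[of u x] by simp

lemma l2_finite_support: "finite {x. u x \<noteq> 0} \<Longrightarrow> u \<in> l2"
  unfolding l2_iff by (rule finite_nonzero_values_imp_summable_on) simp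

subsection \<open>Inner product\<close>

lemma
  assumes "u \<in> l2" "v \<in> l2"
  shows l2_abs_summable: "(\<lambda>x. norm (conj (u x) * v x)) summable_on UNIV"
    and Cauchy_Schwarz_l2: "norm (l2_inner u v) \<le> l2_norm u * l2_norm v"
proof -
  have fin: "(\<Sum>x\<in>F. norm (conj (u x) * v x)) \<le> l2_norm u * l2_norm v" if F: "finite F" for F
  proof -
    have "(\<Sum>x\<in>F. norm (conj (u x) * v x))
        \<le> L2_set (\<lambda>x. norm (u x)) F * L2_set (\<lambda>x. norm (v x)) F"
      using L2_set_mult_ineq[of "\<lambda>x. norm (u x)" "\<lambda>x. norm (v x)" F] by (simp add: norm_mult)
    also have "\<dots> \<le> l2_norm u * l2_norm v"
      by (intro mult_mono L2_set_le_l2_norm assms F) simp_all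
    finally show ?thesis .
  qed
  then show summ: "(\<lambda>x. norm (conj (u x) * v x)) summable_on UNIV"
    by (intro nonneg_bdd_above_summable_on) (auto intro!: bdd_aboveI)
  have "norm (l2_inner u v) \<le> (\<Sum>\<^sub>\<infinity>x. norm (conj (u x) * v x))"
    unfolding l2_inner_def using summ by (rule norm_infsum_bound)
  also have "\<dots> \<le> l2_norm u * l2_norm v"
    using summ fin by (intro infsum_le_finite_sums) auto
  finally show "norm (l2_inner u v) \<le> l2_norm u * l2_norm v" .
qed

lemma l2_summable: "u \<in> l2 \<Longrightarrow> v \<in> l2 \<Longrightarrow> (\<lambda>x. conj (u x) * v x) summable_on UNIV"
  by (rule abs_summable_summable) (rule l2_abs_summable)

lemma l2_inner_commute:
  assumes "u \<in> l2" "v \<in> l2" shows "l2_inner v u = conj (l2_inner u v)"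
proof -
  have "((\<lambda>x. conj (conj (u x) * v x)) has_sum conj (l2_inner u v)) UNIV"
    unfolding l2_inner_def
    by (intro has_sum_bounded_linear[OF bounded_linear_conj] has_sum_infsum l2_summable assms)
  then show ?thesis
    by (simp add: l2_inner_def conj_mult conj_conj mult.commute infsumI)
qed

lemma l2_inner_self: "u \<in> l2 \<Longrightarrow> l2_inner u u = of_real ((l2_norm u)\<^sup>2)"
  by (simp add: l2_inner_self_infsum power2_l2_norm del: of_real_power)

lemma l2_inner_add_right:
  "u \<in> l2 \<Longrightarrow> v \<in> l2 \<Longrightarrow> w \<in> l2 \<Longrightarrow> l2_inner u (\<lambda>x. v x + w x) = l2_inner u v + l2_inner u w"
  by (simp add: l2_inner_def distrib_left infsum_add l2_summable)

lemma l2_inner_add_left: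
  "u \<in> l2 \<Longrightarrow> v \<in> l2 \<Longrightarrow> w \<in> l2 \<Longrightarrow> l2_inner (\<lambda>x. v x + w x) u = l2_inner v u + l2_inner w u"
  by (simp add: l2_inner_def conj_add distrib_right infsum_add l2_summable)

lemma l2_inner_scale_right: "l2_inner u (\<lambda>x. a * v x) = a * l2_inner u v"
  by (simp add: l2_inner_def infsum_cmult_right' mult.left_commute)

lemma l2_inner_scale_left: "l2_inner (\<lambda>x. a * v x) u = conj a * l2_inner v u"
  by (simp add: l2_inner_def infsum_cmult_right' mult.assoc conj_mult)

lemma l2_inner_diff_left:
  "u \<in> l2 \<Longrightarrow> v \<in> l2 \<Longrightarrow> w \<in> l2 \<Longrightarrow> l2_inner (\<lambda>x. v x - w x) u = l2_inner v u - l2_inner w u"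
  using l2_inner_add_left[of u v "\<lambda>x. (- 1) * w x"] l2_scale[of w "- 1"]
  by (simp only: l2_inner_scale_left) (simp add: conj_minus)

lemma l2_inner_diff_right:
  "u \<in> l2 \<Longrightarrow> v \<in> l2 \<Longrightarrow> w \<in> l2 \<Longrightarrow> l2_inner u (\<lambda>x. v x - w x) = l2_inner u v - l2_inner u w"
  using l2_inner_add_right[of u v "\<lambda>x. (- 1) * w x"] l2_scale[of w "- 1"]
  by (simp only: l2_inner_scale_right) simp

lemma l2_inner_tendsto:
  assumes "\<And>n. X n \<in> l2" "g \<in> l2" "u \<in> l2" "vconverges l2_space X g"
  shows "(\<lambda>n. l2_inner u (X n)) \<longlonglongrightarrow> l2_inner u g"
proof -
  have "norm (l2_inner u (X n) - l2_inner u g) \<le> l2_norm u * l2_norm (\<lambda>x. X n x - g x)" for n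
    using Cauchy_Schwarz_l2[of u "\<lambda>x. X n x - g x"] assms
    by (simp add: l2_inner_diff_right l2_diff)
  moreover have "(\<lambda>n. l2_norm u * l2_norm (\<lambda>x. X n x - g x)) \<longlonglongrightarrow> 0"
    using tendsto_mult_right_zero[of _ _ "l2_norm u"] assms(4) by (simp add: vconverges_l2)
  ultimately show ?thesis
    by (subst LIM_zero_iff[symmetric]) (rule tendsto_0_le[where K=1], assumption, simp)
qed

lemma l2_norm_tendsto:
  assumes "\<And>n. X n \<in> l2" "g \<in> l2" "vconverges l2_space X g"
  shows "(\<lambda>n. l2_norm (X n)) \<longlonglongrightarrow> l2_norm g"
proof -
  have "norm (l2_norm (X n) - l2_norm g) \<le> l2_norm (\<lambda>x. X n x - g x)" for n
  proof -
    have "l2_norm (X n) \<le> l2_norm (\<lambda>x. X n x - g x) + l2_norm g"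
      using l2_triangle(2)[of "\<lambda>x. X n x - g x" g] assms by (simp add: l2_diff)
    moreover have "l2_norm g \<le> l2_norm (X n) + l2_norm (\<lambda>x. X n x - g x)"
      using l2_norm_diff[of "X n" "\<lambda>x. X n x - g x"] assms by (simp add: l2_diff)
    ultimately show ?thesis by simp
  qed
  then show ?thesis
    using assms(3) unfolding vconverges_l2
    by (subst LIM_zero_iff[symmetric]) (rule tendsto_0_le[where K=1], assumption, simp)
qed

lemma l2_pointwise_tendsto:
  assumes "\<And>n. X n \<in> l2" "g \<in> l2" "vconverges l2_space X g"
  shows "(\<lambda>n. X n x) \<longlonglongrightarrow> g x"
proof -
  have "norm (X n x - g x) \<le> l2_norm (\<lambda>x. X n x - g x)" for n
    using norm_le_l2_norm[of "\<lambda>x. X n x - g x" x] assms by (simp add: l2_diff)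
  then show ?thesis
    using assms(3) unfolding vconverges_l2
    by (subst LIM_zero_iff[symmetric]) (rule tendsto_0_le[where K=1], assumption, simp)
qed

subsection \<open>Completeness\<close>

lemma l2_complete:
  fixes X :: "nat \<Rightarrow> 'i \<Rightarrow> 'k::conj_scalar"
  assumes X: "\<And>n. X n \<in> l2"
    and Cauchy: "\<And>e. 0 < e \<Longrightarrow> \<exists>N. \<forall>m\<ge>N. \<forall>n\<ge>N. l2_norm (\<lambda>x. X m x - X n x) \<le> e"
  shows "\<exists>g \<in> l2. vconverges l2_space X g"
proof -
  have diff: "(\<lambda>x. X m x - X n x) \<in> l2" for m n by (intro l2_diff X)
  have "Cauchy (\<lambda>n. X n x)" for x
  proof (rule metric_CauchyI)
    fix e :: real assume "0 < e"
    then obtain N where "\<forall>m\<ge>N. \<forall>n\<ge>N. l2_norm (\<lambda>x. X m x - X n x) \<le> e / 2"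
      using Cauchy[of "e / 2"] by auto
    moreover have "norm (X m x - X n x) \<le> l2_norm (\<lambda>x. X m x - X n x)" for m n
      using norm_le_l2_norm[where x = x, OF diff[of m n]] .
    ultimately have "\<forall>m\<ge>N. \<forall>n\<ge>N. dist (X m x) (X n x) \<le> e / 2"
      unfolding dist_norm by (meson order_trans)
    then have "\<forall>m\<ge>N. \<forall>n\<ge>N. dist (X m x) (X n x) < e"
      using \<open>0 < e\<close> by fastforce
    then show "\<exists>M. \<forall>m\<ge>M. \<forall>n\<ge>M. dist (X m x) (X n x) < e" by blast
  qed
  then have "\<exists>l. (\<lambda>n. X n x) \<longlonglongrightarrow> l" for x
    by (simp add: Cauchy_convergent_iff convergent_def)
  then obtain g where g: "\<And>x. (\<lambda>n. X n x) \<longlonglongrightarrow> g x" by metis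
  have bound: "L2_set (\<lambda>x. norm (X m x - g x)) F \<le> e"
    if N: "\<forall>m\<ge>N. \<forall>n\<ge>N. l2_norm (\<lambda>x. X m x - X n x) \<le> e" and "m \<ge> N" "finite F" for m N e F
  proof (rule tendsto_upperbound)
    show "(\<lambda>n. L2_set (\<lambda>x. norm (X m x - X n x)) F) \<longlonglongrightarrow> L2_set (\<lambda>x. norm (X m x - g x)) F"
      unfolding L2_set_def by (intro tendsto_intros g)
    show "\<forall>\<^sub>F n in sequentially. L2_set (\<lambda>x. norm (X m x - X n x)) F \<le> e"
      using N \<open>m \<ge> N\<close> L2_set_le_l2_norm[OF diff \<open>finite F\<close>]
      by (intro eventually_sequentiallyI[of N]) (meson order_trans)
  qed simp
  obtain N where "\<forall>m\<ge>N. \<forall>n\<ge>N. l2_norm (\<lambda>x. X m x - X n x) \<le> 1" using Cauchy[of 1] by auto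
  then have "(\<lambda>x. X N x - g x) \<in> l2"
    by (intro l2_boundedI(1)[of _ 1] bound[where N=N]) auto
  from l2_diff[OF X[of N] this] have "g \<in> l2" by simp
  moreover have "vconverges l2_space X g"
    unfolding vconverges_l2
  proof (rule LIMSEQ_I)
    fix e :: real assume "0 < e"
    then obtain N where N: "\<forall>m\<ge>N. \<forall>n\<ge>N. l2_norm (\<lambda>x. X m x - X n x) \<le> e / 2"
      using Cauchy[of "e / 2"] by auto
    have "l2_norm (\<lambda>x. X m x - g x) \<le> e / 2" if "m \<ge> N" for m
      by (intro l2_boundedI(2) bound[OF N that])
    then show "\<exists>N. \<forall>n\<ge>N. norm (l2_norm (\<lambda>x. X n x - g x) - 0) < e"
      using \<open>0 < e\<close> by (intro exI[of _ N]) fastforce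
  qed
  ultimately show ?thesis by blast
qed

subsection \<open>Orthogonal projection\<close>

lemma l2_parallelogram:
  fixes u v :: "'i \<Rightarrow> 'k::conj_scalar"
  assumes "u \<in> l2" "v \<in> l2"
  shows "(l2_norm (\<lambda>x. u x + v x))\<^sup>2 + (l2_norm (\<lambda>x. u x - v x))\<^sup>2
       = 2 * (l2_norm u)\<^sup>2 + 2 * (l2_norm v)\<^sup>2"
proof -
  have "(of_real ((l2_norm (\<lambda>x. u x + v x))\<^sup>2 + (l2_norm (\<lambda>x. u x - v x))\<^sup>2) :: 'k)
       = of_real (2 * (l2_norm u)\<^sup>2 + 2 * (l2_norm v)\<^sup>2)"
    using assms
    by (simp add: l2_inner_self[symmetric] l2_inner_add_left l2_inner_add_right
        l2_inner_diff_left l2_inner_diff_right l2_triangle l2_diff algebra_simps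
        del: of_real_power of_real_eq_iff)
  then show ?thesis by (simp only: of_real_eq_iff)
qed

text \<open>
  A minimiser of the distance is orthogonal: moving it by a small multiple of
  \<open>\<langle>s, h\<rangle> s\<close> would otherwise decrease the norm.
\<close>

lemma l2_minimal_orthogonal:
  fixes h s :: "'i \<Rightarrow> 'k::conj_scalar"
  assumes h: "h \<in> l2" and s: "s \<in> l2"
    and min: "\<And>t. l2_norm h \<le> l2_norm (\<lambda>x. h x + t * s x)"
  shows "l2_inner h s = 0"
proof -
  define a where "a = l2_inner s h"
  define r where "r = 1 / (1 + (l2_norm s)\<^sup>2)"
  define t :: 'k where "t = - of_real r * a"
  have r: "0 < r" "r * (l2_norm s)\<^sup>2 \<le> 1"
    by (auto simp: r_def divide_simps add_pos_nonneg)
  have hs: "l2_inner h s = conj a" unfolding a_def by (rule l2_inner_commute[OF s h])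
  have ts: "(\<lambda>x. t * s x) \<in> l2" by (rule l2_scale[OF s])
  have "(of_real ((l2_norm (\<lambda>x. h x + t * s x))\<^sup>2) :: 'k)
      = l2_inner h h + t * conj a + conj t * a + conj t * t * l2_inner s s"
    using h s ts
    by (subst l2_inner_self[symmetric])
       (simp_all add: l2_inner_add_left l2_inner_add_right l2_triangle(1) l2_inner_scale_left
         l2_inner_scale_right hs a_def[symmetric] algebra_simps)
  also have "\<dots> = l2_inner h h - 2 * of_real r * (conj a * a)
      + of_real r * of_real r * (conj a * a) * l2_inner s s"
    by (simp add: t_def conj_mult conj_minus conj_of_real algebra_simps)
  also have "\<dots> = of_real ((l2_norm h)\<^sup>2 - 2 * r * (norm a)\<^sup>2 + r * (r * (l2_norm s)\<^sup>2) * (norm a)\<^sup>2)"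
    unfolding conj_mult_self' l2_inner_self[OF h] l2_inner_self[OF s]
    by (simp add: algebra_simps)
  finally have "(l2_norm (\<lambda>x. h x + t * s x))\<^sup>2
      = (l2_norm h)\<^sup>2 - 2 * r * (norm a)\<^sup>2 + r * (r * (l2_norm s)\<^sup>2) * (norm a)\<^sup>2"
    by (simp only: of_real_eq_iff)
  moreover have "(l2_norm h)\<^sup>2 \<le> (l2_norm (\<lambda>x. h x + t * s x))\<^sup>2"
    by (intro power_mono min) simp
  moreover have "r * (r * (l2_norm s)\<^sup>2) * (norm a)\<^sup>2 \<le> r * 1 * (norm a)\<^sup>2"
    using r by (intro mult_right_mono mult_left_mono) auto
  ultimately have "r * (norm a)\<^sup>2 \<le> 0" by simp
  then have "a = 0" using r by (simp add: mult_le_0_iff)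
  then show ?thesis by (simp add: hs)
qed

text \<open>
  The projection of \<open>f\<close> onto the closure of a subspace \<open>S\<close>, which is exhibited as the limit of a
  sequence in \<open>S\<close>.
\<close>

lemma l2_projection:
  fixes S :: "('i \<Rightarrow> 'k::conj_scalar) set"
  assumes S: "S \<subseteq> l2" "S \<noteq> {}"
    and add: "\<And>u v. u \<in> S \<Longrightarrow> v \<in> S \<Longrightarrow> (\<lambda>x. u x + v x) \<in> S"
    and scale: "\<And>a u. u \<in> S \<Longrightarrow> (\<lambda>x. a * u x) \<in> S"
    and f: "f \<in> l2"
  obtains X g where "\<And>n. X n \<in> S" "g \<in> l2" "vconverges l2_space X g"
    "\<And>s. s \<in> S \<Longrightarrow> l2_inner (\<lambda>x. g x - f x) s = 0"
proof -
  define D where "D s = (l2_norm (\<lambda>x. s x - f x))\<^sup>2" for s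
  define d where "d = Inf (D ` S)"
  have bdd: "bdd_below (D ` S)" by (rule bdd_belowI[of _ 0]) (auto simp: D_def)
  have d_le: "d \<le> D s" if "s \<in> S" for s
    unfolding d_def using that by (intro cInf_lower bdd) auto
  have "\<exists>s\<in>S. D s < d + 1 / real (Suc n)" for n
    using cInf_lessD[of "D ` S" "d + 1 / real (Suc n)"] S(2) by (auto simp: d_def)
  then obtain X where X: "\<And>n. X n \<in> S" and DX: "\<And>n. D (X n) < d + 1 / real (Suc n)" by metis
  have Xl2: "X n \<in> l2" for n using X S by auto
  have dist: "(l2_norm (\<lambda>x. X m x - X n x))\<^sup>2 \<le> 2 / real (Suc m) + 2 / real (Suc n)" for m n
  proof -
    define M where "M x = (1 / 2) * (X m x + X n x)" for x
    have "M \<in> S" unfolding M_def by (intro scale add X)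
    have "(\<lambda>x. (X m x - f x) + (X n x - f x)) = (\<lambda>x. 2 * (M x - f x))"
      by (auto simp: M_def algebra_simps)
    then have "(l2_norm (\<lambda>x. (X m x - f x) + (X n x - f x)))\<^sup>2 = 4 * D M"
      by (simp only: l2_norm_scale D_def) (simp add: power_mult_distrib)
    moreover have "(\<lambda>x. (X m x - f x) - (X n x - f x)) = (\<lambda>x. X m x - X n x)" by auto
    ultimately have "4 * D M + (l2_norm (\<lambda>x. X m x - X n x))\<^sup>2 = 2 * D (X m) + 2 * D (X n)"
      using l2_parallelogram[OF l2_diff[OF Xl2 f] l2_diff[OF Xl2 f], of m n] by (simp add: D_def)
    then have "(l2_norm (\<lambda>x. X m x - X n x))\<^sup>2 \<le> 2 * (1 / real (Suc m)) + 2 * (1 / real (Suc n))"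
      using d_le[OF \<open>M \<in> S\<close>] DX[of m] DX[of n] by linarith
    then show ?thesis by simp
  qed
  have "\<exists>N. \<forall>m\<ge>N. \<forall>n\<ge>N. l2_norm (\<lambda>x. X m x - X n x) \<le> e" if "0 < e" for e
  proof -
    obtain N where N: "4 / e\<^sup>2 < real N" using reals_Archimedean2 by blast
    have "l2_norm (\<lambda>x. X m x - X n x) \<le> e" if "m \<ge> N" "n \<ge> N" for m n
    proof (rule power2_le_imp_le)
      have *: "2 / real (Suc k) \<le> e\<^sup>2 / 2" if "k \<ge> N" for k
      proof -
        have "4 / e\<^sup>2 < real (Suc k)" using N that by simp
        then show ?thesis using \<open>0 < e\<close> by (simp add: field_simps)
      qed
      show "(l2_norm (\<lambda>x. X m x - X n x))\<^sup>2 \<le> e\<^sup>2"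
        using dist[of m n] *[OF \<open>m \<ge> N\<close>] *[OF \<open>n \<ge> N\<close>] by simp
    qed (use \<open>0 < e\<close> in simp)
    then show ?thesis by blast
  qed
  from l2_complete[OF Xl2 this] obtain g where g: "g \<in> l2" and lim: "vconverges l2_space X g"
    by blast
  show thesis
  proof (rule that[OF X g lim])
    fix s assume "s \<in> S"
    then have s: "s \<in> l2" using S by auto
    have conv: "(\<lambda>n. l2_norm (\<lambda>x. X n x - f x + t * s x)) \<longlonglongrightarrow> l2_norm (\<lambda>x. g x - f x + t * s x)" for t
    proof (rule l2_norm_tendsto)
      show "vconverges l2_space (\<lambda>n x. X n x - f x + t * s x) (\<lambda>x. g x - f x + t * s x)"
        using lim by (simp add: vconverges_l2)
    qed (intro l2_triangle(1) l2_diff l2_scale Xl2 f g s)+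
    have "(\<lambda>n. D (X n)) \<longlonglongrightarrow> d"
    proof (rule real_tendsto_sandwich[of "\<lambda>_. d" _ _ "\<lambda>n. d + 1 / real (Suc n)"])
      show "\<forall>\<^sub>F n in sequentially. D (X n) \<le> d + 1 / real (Suc n)"
        using DX by (simp add: less_imp_le)
      show "(\<lambda>n. d + 1 / real (Suc n)) \<longlonglongrightarrow> d"
        using tendsto_add[OF tendsto_const LIMSEQ_Suc[OF lim_1_over_n], of d] by simp
    qed (use d_le X in auto)
    moreover have "(\<lambda>n. D (X n)) \<longlonglongrightarrow> (l2_norm (\<lambda>x. g x - f x))\<^sup>2"
      unfolding D_def using conv[of 0] by (intro tendsto_power) simp
    ultimately have d_eq: "d = (l2_norm (\<lambda>x. g x - f x))\<^sup>2"
      using LIMSEQ_unique by blast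
    show "l2_inner (\<lambda>x. g x - f x) s = 0"
    proof (rule l2_minimal_orthogonal)
      fix t
      have "d \<le> (l2_norm (\<lambda>x. g x - f x + t * s x))\<^sup>2"
      proof (rule tendsto_lowerbound)
        show "(\<lambda>n. (l2_norm (\<lambda>x. X n x - f x + t * s x))\<^sup>2)
            \<longlonglongrightarrow> (l2_norm (\<lambda>x. g x - f x + t * s x))\<^sup>2"
          by (intro tendsto_power conv)
        have "d \<le> (l2_norm (\<lambda>x. X n x - f x + t * s x))\<^sup>2" for n
          using d_le[OF add[OF X[of n] scale[OF \<open>s \<in> S\<close>, of t]]]
          by (simp add: D_def algebra_simps)
        then show "\<forall>\<^sub>F n in sequentially. d \<le> (l2_norm (\<lambda>x. X n x - f x + t * s x))\<^sup>2" by simp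
      qed simp
      then show "l2_norm (\<lambda>x. g x - f x) \<le> l2_norm (\<lambda>x. g x - f x + t * s x)"
        unfolding d_eq by (rule power2_le_imp_le) simp
    qed (intro l2_diff g f s)+
  qed
qed

section \<open>Inner product spaces with coordinates\<close>

text \<open>
  An inner product space \<open>H\<close> together with a linear isometric embedding \<open>\<phi>\<close> into square-summable
  functions. Vector identities in \<open>H\<close> become pointwise identities between the coordinates.
\<close>

locale l2_coordinates =
  fixes H :: "('k::conj_scalar, 'a) inner_space" and \<phi> :: "'a \<Rightarrow> 'i \<Rightarrow> 'k"
  assumes coord_l2: "x \<in> vecs H \<Longrightarrow> \<phi> x \<in> l2"
    and coord_inj: "inj_on \<phi> (vecs H)"
    and add_closed: "x \<in> vecs H \<Longrightarrow> y \<in> vecs H \<Longrightarrow> vadd H x y \<in> vecs H"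
    and coord_add: "x \<in> vecs H \<Longrightarrow> y \<in> vecs H \<Longrightarrow> \<phi> (vadd H x y) = (\<lambda>i. \<phi> x i + \<phi> y i)"
    and scale_closed: "x \<in> vecs H \<Longrightarrow> vscale H a x \<in> vecs H"
    and coord_scale: "x \<in> vecs H \<Longrightarrow> \<phi> (vscale H a x) = (\<lambda>i. a * \<phi> x i)"
    and coord_inner: "x \<in> vecs H \<Longrightarrow> y \<in> vecs H \<Longrightarrow> vinner H x y = l2_inner (\<phi> x) (\<phi> y)"
begin

lemma eqI: "x \<in> vecs H \<Longrightarrow> y \<in> vecs H \<Longrightarrow> (\<And>i. \<phi> x i = \<phi> y i) \<Longrightarrow> x = y"
  using coord_inj by (auto simp: inj_on_def fun_eq_iff)

lemma diff_closed: "x \<in> vecs H \<Longrightarrow> y \<in> vecs H \<Longrightarrow> vdiff H x y \<in> vecs H"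
  by (simp add: vdiff_def add_closed scale_closed)

lemma coord_diff: "x \<in> vecs H \<Longrightarrow> y \<in> vecs H \<Longrightarrow> \<phi> (vdiff H x y) = (\<lambda>i. \<phi> x i - \<phi> y i)"
  by (simp add: vdiff_def coord_add scale_closed coord_scale)

lemmas closed = add_closed scale_closed diff_closed
lemmas coords = coord_add coord_scale coord_diff

lemma norm_eq: "x \<in> vecs H \<Longrightarrow> vnorm H x = l2_norm (\<phi> x)"
  by (simp add: vnorm_def coord_inner)

lemma norm_nonneg [simp]: "0 \<le> vnorm H x"
  by (simp add: vnorm_def)

lemma inner_self: "x \<in> vecs H \<Longrightarrow> vinner H x x = of_real ((vnorm H x)\<^sup>2)"
  by (simp add: coord_inner norm_eq l2_inner_self coord_l2 del: of_real_power)

lemma inner_commute: "x \<in> vecs H \<Longrightarrow> y \<in> vecs H \<Longrightarrow> vinner H y x = conj (vinner H x y)"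
  by (simp only: coord_inner) (intro l2_inner_commute coord_l2)

lemma Cauchy_Schwarz:
  "x \<in> vecs H \<Longrightarrow> y \<in> vecs H \<Longrightarrow> norm (vinner H x y) \<le> vnorm H x * vnorm H y"
  by (simp add: coord_inner norm_eq Cauchy_Schwarz_l2 coord_l2)

lemma inner_add_left:
  "x \<in> vecs H \<Longrightarrow> y \<in> vecs H \<Longrightarrow> z \<in> vecs H \<Longrightarrow>
    vinner H (vadd H x y) z = vinner H x z + vinner H y z"
  by (simp add: coord_inner closed coords l2_inner_add_left coord_l2)

lemma inner_scale_left:
  "x \<in> vecs H \<Longrightarrow> y \<in> vecs H \<Longrightarrow> vinner H (vscale H a x) y = conj a * vinner H x y"
  by (simp add: coord_inner closed coords l2_inner_scale_left)

lemma norm_triangle: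
  "x \<in> vecs H \<Longrightarrow> y \<in> vecs H \<Longrightarrow> vnorm H (vadd H x y) \<le> vnorm H x + vnorm H y"
  by (simp add: norm_eq closed coords l2_triangle coord_l2)

lemma norm_triangle_diff:
  "x \<in> vecs H \<Longrightarrow> y \<in> vecs H \<Longrightarrow> vnorm H (vdiff H x y) \<le> vnorm H x + vnorm H y"
  by (simp add: norm_eq closed coords l2_norm_diff coord_l2)

lemma norm_scale: "x \<in> vecs H \<Longrightarrow> vnorm H (vscale H a x) = norm a * vnorm H x"
  by (simp add: norm_eq closed coords l2_norm_scale)

lemma norm_eq_0_imp_eq:
  assumes "x \<in> vecs H" "y \<in> vecs H" "vnorm H (vdiff H x y) = 0"
  shows "x = y"
proof (rule eqI[OF assms(1,2)])
  fix i
  have "l2_norm (\<lambda>i. \<phi> x i - \<phi> y i) = 0"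
    using assms by (simp add: norm_eq closed coords)
  then show "\<phi> x i = \<phi> y i"
    using l2_norm_eq_0[of "\<lambda>i. \<phi> x i - \<phi> y i" i] assms by (simp add: l2_diff coord_l2)
qed

lemma converges_iff:
  assumes "\<And>n. X n \<in> vecs H" "x \<in> vecs H"
  shows "vconverges H X x \<longleftrightarrow> vconverges l2_space (\<lambda>n. \<phi> (X n)) (\<phi> x)"
  using assms by (simp add: vconverges_def norm_eq closed coords)

lemma converges_add:
  assumes "\<And>n. X n \<in> vecs H" "x \<in> vecs H" "vconverges H X x"
    and "\<And>n. Y n \<in> vecs H" "y \<in> vecs H" "vconverges H Y y"
  shows "vconverges H (\<lambda>n. vadd H (X n) (Y n)) (vadd H x y)"
proof -
  have le: "vnorm H (vdiff H (vadd H (X n) (Y n)) (vadd H x y))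
      \<le> vnorm H (vdiff H (X n) x) + vnorm H (vdiff H (Y n) y)" for n
  proof -
    have "vdiff H (vadd H (X n) (Y n)) (vadd H x y) = vadd H (vdiff H (X n) x) (vdiff H (Y n) y)"
      using assms by (intro eqI) (simp_all add: closed coords)
    then show ?thesis using assms by (simp add: norm_triangle closed)
  qed
  have "(\<lambda>n. vnorm H (vdiff H (X n) x) + vnorm H (vdiff H (Y n) y)) \<longlonglongrightarrow> 0"
    using assms(3,6) unfolding vconverges_def by (rule tendsto_add_zero)
  then show ?thesis
    unfolding vconverges_def by (rule tendsto_0_le[where K=1]) (simp add: le abs_of_nonneg)
qed

lemma converges_scale:
  assumes "\<And>n. X n \<in> vecs H" "x \<in> vecs H" "vconverges H X x"
  shows "vconverges H (\<lambda>n. vscale H a (X n)) (vscale H a x)"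
proof -
  have "vnorm H (vdiff H (vscale H a (X n)) (vscale H a x)) = norm a * vnorm H (vdiff H (X n) x)" for n
  proof -
    have "vdiff H (vscale H a (X n)) (vscale H a x) = vscale H a (vdiff H (X n) x)"
      using assms by (intro eqI) (simp_all add: closed coords algebra_simps)
    then show ?thesis using assms by (simp add: norm_scale closed)
  qed
  then show ?thesis
    using tendsto_mult_right_zero[OF assms(3)[unfolded vconverges_def], of "norm a"]
    by (simp add: vconverges_def)
qed

lemma inner_tendsto:
  assumes "\<And>n. X n \<in> vecs H" "x \<in> vecs H" "y \<in> vecs H" "vconverges H X x"
  shows "(\<lambda>n. vinner H y (X n)) \<longlonglongrightarrow> vinner H y x"
  using l2_inner_tendsto[of "\<lambda>n. \<phi> (X n)" "\<phi> x" "\<phi> y"] assms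
  by (simp add: converges_iff coord_l2 coord_inner)

end

lemma l2_coordinates_l2_space: "l2_coordinates l2_space (\<lambda>u. u)"
  by unfold_locales (simp_all add: l2_triangle l2_scale)

section \<open>Linear operators\<close>

text \<open>
  The graph is closed under sums and scalar multiples in \<open>H \<times> K\<close>. It need not be single-valued, so that
  adjoints of operators without dense domain are covered.
\<close>

definition linear_operator ::
  "('k::conj_scalar, 'a) inner_space \<Rightarrow> ('k, 'b) inner_space \<Rightarrow> ('a, 'b) operator \<Rightarrow> bool" where
  "linear_operator H K T \<longleftrightarrow> T \<subseteq> vecs H \<times> vecs K \<and>
     (\<forall>x y x' y'. (x, y) \<in> T \<longrightarrow> (x', y') \<in> T \<longrightarrow> (vadd H x x', vadd K y y') \<in> T) \<and>
     (\<forall>a x y. (x, y) \<in> T \<longrightarrow> (vscale H a x, vscale K a y) \<in> T)"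

lemma linear_operatorD:
  assumes "linear_operator H K T"
  shows "(x, y) \<in> T \<Longrightarrow> x \<in> vecs H" "(x, y) \<in> T \<Longrightarrow> y \<in> vecs K"
    and "(x, y) \<in> T \<Longrightarrow> (x', y') \<in> T \<Longrightarrow> (vadd H x x', vadd K y y') \<in> T"
    and "(x, y) \<in> T \<Longrightarrow> (vscale H a x, vscale K a y) \<in> T"
    and "(x, y) \<in> T \<Longrightarrow> (x', y') \<in> T \<Longrightarrow> (vdiff H x x', vdiff K y y') \<in> T"
  using assms unfolding linear_operator_def vdiff_def by blast+

lemma linear_operator_op_closure:
  assumes "l2_coordinates H \<phi>" "l2_coordinates K \<psi>" and T: "linear_operator H K T"
  shows "linear_operator H K (op_closure H K T)"
proof -
  interpret H: l2_coordinates H \<phi> by fact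
  interpret K: l2_coordinates K \<psi> by fact
  show ?thesis
    unfolding linear_operator_def
  proof (intro conjI allI impI)
    show "op_closure H K T \<subseteq> vecs H \<times> vecs K" by (auto simp: op_closure_def)
  next
    fix x y x' y'
    assume "(x, y) \<in> op_closure H K T" "(x', y') \<in> op_closure H K T"
    then obtain X Y X' Y' where
      *: "\<And>n. (X n, Y n) \<in> T" "vconverges H X x" "vconverges K Y y"
         "\<And>n. (X' n, Y' n) \<in> T" "vconverges H X' x'" "vconverges K Y' y'"
      and in_vecs: "x \<in> vecs H" "x' \<in> vecs H" "y \<in> vecs K" "y' \<in> vecs K"
      unfolding op_closure_def by auto
    note [simp] = linear_operatorD(1,2)[OF T *(1)] linear_operatorD(1,2)[OF T *(4)]
    have "vconverges H (\<lambda>n. vadd H (X n) (X' n)) (vadd H x x')"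
      "vconverges K (\<lambda>n. vadd K (Y n) (Y' n)) (vadd K y y')"
      using * in_vecs by (auto intro!: H.converges_add K.converges_add)
    moreover have "\<And>n. (vadd H (X n) (X' n), vadd K (Y n) (Y' n)) \<in> T"
      by (intro linear_operatorD(3)[OF T] *)
    ultimately show "(vadd H x x', vadd K y y') \<in> op_closure H K T"
      unfolding op_closure_def using in_vecs
      by (auto simp: H.closed K.closed intro!: exI[of _ "\<lambda>n. vadd H (X n) (X' n)"]
          exI[of _ "\<lambda>n. vadd K (Y n) (Y' n)"])
  next
    fix a x y
    assume "(x, y) \<in> op_closure H K T"
    then obtain X Y where
      *: "\<And>n. (X n, Y n) \<in> T" "vconverges H X x" "vconverges K Y y"
      and in_vecs: "x \<in> vecs H" "y \<in> vecs K"
      unfolding op_closure_def by auto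
    note [simp] = linear_operatorD(1,2)[OF T *(1)]
    have "vconverges H (\<lambda>n. vscale H a (X n)) (vscale H a x)"
      "vconverges K (\<lambda>n. vscale K a (Y n)) (vscale K a y)"
      using * in_vecs by (auto intro!: H.converges_scale K.converges_scale)
    moreover have "\<And>n. (vscale H a (X n), vscale K a (Y n)) \<in> T"
      by (intro linear_operatorD(4)[OF T] *)
    ultimately show "(vscale H a x, vscale K a y) \<in> op_closure H K T"
      unfolding op_closure_def using in_vecs
      by (auto simp: H.closed K.closed intro!: exI[of _ "\<lambda>n. vscale H a (X n)"]
          exI[of _ "\<lambda>n. vscale K a (Y n)"])
  qed
qed

lemma linear_operator_op_adjoint:
  assumes "l2_coordinates H \<phi>" "l2_coordinates K \<psi>" and T: "T \<subseteq> vecs H \<times> vecs K"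
  shows "linear_operator K H (op_adjoint H K T)"
proof -
  interpret H: l2_coordinates H \<phi> by fact
  interpret K: l2_coordinates K \<psi> by fact
  show ?thesis
    unfolding linear_operator_def
  proof (intro conjI allI impI)
    show "op_adjoint H K T \<subseteq> vecs K \<times> vecs H" by (auto simp: op_adjoint_def)
  next
    fix x y x' y'
    assume "(x, y) \<in> op_adjoint H K T" "(x', y') \<in> op_adjoint H K T"
    then have *: "x \<in> vecs K" "y \<in> vecs H" "x' \<in> vecs K" "y' \<in> vecs H"
      "\<And>v w. (v, w) \<in> T \<Longrightarrow> vinner K x w = vinner H y v"
      "\<And>v w. (v, w) \<in> T \<Longrightarrow> vinner K x' w = vinner H y' v"
      unfolding op_adjoint_def by blast+
    have "vinner K (vadd K x x') w = vinner H (vadd H y y') v" if "(v, w) \<in> T" for v w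
    proof -
      have "v \<in> vecs H" "w \<in> vecs K" using T that by auto
      then show ?thesis using *(1-4) *(5,6)[OF that] by (simp add: H.inner_add_left K.inner_add_left)
    qed
    then show "(vadd K x x', vadd H y y') \<in> op_adjoint H K T"
      using *(1-4) by (auto simp: op_adjoint_def H.closed K.closed)
  next
    fix a x y
    assume "(x, y) \<in> op_adjoint H K T"
    then have *: "x \<in> vecs K" "y \<in> vecs H"
      "\<And>v w. (v, w) \<in> T \<Longrightarrow> vinner K x w = vinner H y v"
      unfolding op_adjoint_def by blast+
    have "vinner K (vscale K a x) w = vinner H (vscale H a y) v" if "(v, w) \<in> T" for v w
    proof -
      have "v \<in> vecs H" "w \<in> vecs K" using T that by auto
      then show ?thesis
        using *(1,2) *(3)[OF that] by (simp add: H.inner_scale_left K.inner_scale_left)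
    qed
    then show "(vscale K a x, vscale H a y) \<in> op_adjoint H K T"
      using *(1,2) by (auto simp: op_adjoint_def H.closed K.closed)
  qed
qed

section \<open>Products of formally adjoint operators\<close>

text \<open>
  Let \<open>f = (B A - \<mu>) u\<close> with \<open>\<mu> \<noteq> 0\<close>, and let \<open>x\<close> be a solution of \<open>(B A + 1) x = f\<close>, so that
  \<open>\<parallel>x\<parallel> \<le> \<parallel>f\<parallel>\<close> and \<open>\<parallel>A x\<parallel> \<le> \<parallel>f\<parallel>\<close>. Then \<open>q = A u - A x\<close> satisfies \<open>B q = \<mu> u + x\<close> and
  \<open>(A B - \<mu>) q = (1 + \<mu>) A x\<close>. Hence the resolvent of \<open>A B\<close> bounds \<open>q\<close>, and with it \<open>u = (B q - x) / \<mu>\<close>.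
  Conversely, if \<open>f\<close> is given, \<open>x\<close> is chosen as above and \<open>q\<close> solves \<open>(A B - \<mu>) q = (1 + \<mu>) A x\<close>, then
  this formula defines a solution \<open>u\<close>. Neither density of the domains nor closedness of the operators
  is used.
\<close>

lemma resolvent_set_product_swap:
  fixes X :: "('k::conj_scalar, 'a) inner_space" and Y :: "('k, 'b) inner_space"
  assumes X: "l2_coordinates X \<phi>" and Y: "l2_coordinates Y \<psi>"
    and A: "linear_operator X Y A" and B: "linear_operator Y X B"
    and adj: "\<And>x y v w. (x, y) \<in> A \<Longrightarrow> (v, w) \<in> B \<Longrightarrow> vinner Y v y = vinner X w x"
    and surj: "\<And>f. f \<in> vecs X \<Longrightarrow> \<exists>x y b. (x, y) \<in> A \<and> (y, b) \<in> B \<and> vadd X b x = f"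
  shows "resolvent_set Y (B O A) - {0} \<subseteq> resolvent_set X (A O B)"
proof
  interpret X: l2_coordinates X \<phi> by fact
  interpret Y: l2_coordinates Y \<psi> by fact
  note A_dom = linear_operatorD(1,2)[OF A] and B_dom = linear_operatorD(1,2)[OF B]
  note AB_simps = X.closed X.coords Y.closed Y.coords
  fix \<mu> assume "\<mu> \<in> resolvent_set Y (B O A) - {0}"
  then have \<mu>: "\<mu> \<noteq> 0"
    and ex: "\<And>z. z \<in> vecs Y \<Longrightarrow> \<exists>p. p \<in> B O A \<and> vdiff Y (snd p) (vscale Y \<mu> (fst p)) = z"
    and "\<exists>C. \<forall>(q, s) \<in> B O A. vnorm Y q \<le> C * vnorm Y (vdiff Y s (vscale Y \<mu> q))"
    unfolding resolvent_set_def by blast+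
  then obtain C where C: "\<And>q s. (q, s) \<in> B O A \<Longrightarrow> vnorm Y q \<le> C * vnorm Y (vdiff Y s (vscale Y \<mu> q))"
    by blast
  define D where "D = \<bar>C\<bar> * norm (1 + \<mu>)"
  define E where "E = norm \<mu> * D + norm (1 + \<mu>)"
  define C' where "C' = (sqrt (D * E) + 1) / norm \<mu>"
  have DE: "0 \<le> D" "0 \<le> E" by (simp_all add: D_def E_def)
  have bound: "vnorm X u \<le> C' * vnorm X (vdiff X w (vscale X \<mu> u))"
    if u: "(u, e) \<in> A" and e: "(e, w) \<in> B" for u e w
  proof -
    define f where "f = vdiff X w (vscale X \<mu> u)"
    note in_vecs = A_dom[OF u] B_dom[OF e]
    have f: "f \<in> vecs X" using in_vecs by (simp add: f_def X.closed)
    obtain x y b where x: "(x, y) \<in> A" and y: "(y, b) \<in> B" and bx: "vadd X b x = f"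
      using surj[OF f] by blast
    note in_vecs = in_vecs A_dom[OF x] B_dom[OF y] f
    have \<phi>_b: "\<phi> b i = \<phi> w i - \<mu> * \<phi> u i - \<phi> x i" for i
      using arg_cong[OF bx, of \<phi>] in_vecs by (simp add: f_def AB_simps fun_eq_iff eq_diff_eq)
    \<comment> \<open>\<open>e = A u\<close>, \<open>w = B A u\<close>, \<open>y = A x\<close>, \<open>b = B A x\<close>, \<open>r = B q\<close> and \<open>s = A B q\<close>.\<close>
    define q where "q = vdiff Y e y"
    define r where "r = vdiff X w b"
    define s where "s = vadd Y (vscale Y \<mu> e) y"
    have qr: "(q, r) \<in> B" unfolding q_def r_def by (intro linear_operatorD(5)[OF B] e y)
    have "r = vadd X (vscale X \<mu> u) x"
      using in_vecs by (intro X.eqI) (simp_all add: r_def AB_simps \<phi>_b)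
    then have rs: "(r, s) \<in> A" unfolding s_def by (simp add: linear_operatorD(3,4)[OF A] u x)
    note in_vecs = in_vecs B_dom[OF qr] A_dom[OF rs]
    have xy: "(vnorm X x)\<^sup>2 + (vnorm Y y)\<^sup>2 \<le> vnorm X f * vnorm X x"
    proof -
      have "vinner X f x = vinner X b x + vinner X x x"
        unfolding bx[symmetric] using in_vecs by (simp add: X.inner_add_left)
      also have "\<dots> = of_real ((vnorm X x)\<^sup>2 + (vnorm Y y)\<^sup>2)"
        using adj[OF x y] in_vecs by (simp add: X.inner_self Y.inner_self)
      finally have "norm (vinner X f x) = (vnorm X x)\<^sup>2 + (vnorm Y y)\<^sup>2"
        by (simp only: norm_of_real) simp
      then show ?thesis using X.Cauchy_Schwarz[of f x] in_vecs by simp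
    qed
    have "(vnorm X x)\<^sup>2 \<le> vnorm X f * vnorm X x"
      using xy zero_le_power2[of "vnorm Y y"] by linarith
    then have "vnorm X x * vnorm X x \<le> vnorm X f * vnorm X x"
      by (simp only: power2_eq_square)
    then have x_le: "vnorm X x \<le> vnorm X f"
      using X.norm_nonneg[of x] X.norm_nonneg[of f] mult_right_le_imp_le[of "vnorm X x"]
      by (cases "0 < vnorm X x") (blast, linarith)
    have "(vnorm Y y)\<^sup>2 \<le> vnorm X f * vnorm X x"
      using xy zero_le_power2[of "vnorm X x"] by linarith
    also have "\<dots> \<le> (vnorm X f)\<^sup>2"
      using x_le by (simp add: power2_eq_square mult_left_mono)
    finally have "(vnorm Y y)\<^sup>2 \<le> (vnorm X f)\<^sup>2" .
    then have y_le: "vnorm Y y \<le> vnorm X f" by (rule power2_le_imp_le) simp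
    have "vdiff Y s (vscale Y \<mu> q) = vscale Y (1 + \<mu>) y"
      using in_vecs by (intro Y.eqI) (simp_all add: s_def q_def AB_simps algebra_simps)
    then have "vnorm Y q \<le> C * (norm (1 + \<mu>) * vnorm Y y)"
      using C[of q s] qr rs in_vecs by (auto simp: Y.norm_scale)
    also have "\<dots> \<le> \<bar>C\<bar> * (norm (1 + \<mu>) * vnorm X f)"
      using y_le by (intro mult_mono) (auto intro!: mult_left_mono)
    finally have q_le: "vnorm Y q \<le> D * vnorm X f" by (simp add: D_def mult.assoc)
    have "s = vadd Y (vscale Y \<mu> q) (vscale Y (1 + \<mu>) y)"
      using in_vecs by (intro Y.eqI) (simp_all add: s_def q_def AB_simps algebra_simps)
    then have "vnorm Y s \<le> norm \<mu> * vnorm Y q + norm (1 + \<mu>) * vnorm Y y"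
      using Y.norm_triangle[of "vscale Y \<mu> q" "vscale Y (1 + \<mu>) y"] in_vecs
      by (simp add: Y.norm_scale Y.closed)
    also have "\<dots> \<le> norm \<mu> * (D * vnorm X f) + norm (1 + \<mu>) * vnorm X f"
      using q_le y_le by (intro add_mono mult_left_mono) auto
    finally have s_le: "vnorm Y s \<le> E * vnorm X f" by (simp add: E_def algebra_simps)
    have "(vnorm X r)\<^sup>2 = norm (vinner Y q s)"
      using adj[OF rs qr] in_vecs by (simp add: X.inner_self del: of_real_power)
    also have "\<dots> \<le> vnorm Y q * vnorm Y s" using in_vecs by (simp add: Y.Cauchy_Schwarz)
    also have "\<dots> \<le> (D * vnorm X f) * (E * vnorm X f)"
      using q_le s_le DE by (intro mult_mono) auto
    also have "\<dots> = (sqrt (D * E) * vnorm X f)\<^sup>2"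
      using DE by (simp add: power_mult_distrib) (simp add: power2_eq_square)
    finally have r_le: "vnorm X r \<le> sqrt (D * E) * vnorm X f"
      by (rule power2_le_imp_le) (simp add: DE)
    have "vscale X \<mu> u = vdiff X r x"
      using in_vecs by (intro X.eqI) (simp_all add: r_def AB_simps \<phi>_b)
    then have "norm \<mu> * vnorm X u \<le> vnorm X r + vnorm X x"
      using X.norm_triangle_diff[of r x] X.norm_scale[of u \<mu>] in_vecs by simp
    also have "\<dots> \<le> (sqrt (D * E) + 1) * vnorm X f"
      using r_le x_le by (simp add: distrib_right)
    finally show ?thesis
      using \<mu> by (simp add: C'_def f_def field_simps)
  qed
  have "\<exists>!p. p \<in> A O B \<and> vdiff X (snd p) (vscale X \<mu> (fst p)) = f" if f: "f \<in> vecs X" for f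
  proof (rule ex_ex1I)
    obtain x y b where x: "(x, y) \<in> A" and y: "(y, b) \<in> B" and bx: "vadd X b x = f"
      using surj[OF f] by blast
    note in_vecs = f A_dom[OF x] B_dom[OF y]
    have \<phi>_f: "\<phi> f i = \<phi> b i + \<phi> x i" for i
      using in_vecs by (simp add: bx[symmetric] AB_simps)
    obtain q r s where qr: "(q, r) \<in> B" and rs: "(r, s) \<in> A"
      and qs: "vdiff Y s (vscale Y \<mu> q) = vscale Y (1 + \<mu>) y"
      using ex[of "vscale Y (1 + \<mu>) y"] in_vecs by (auto simp: Y.closed)
    note in_vecs = in_vecs B_dom[OF qr] A_dom[OF rs]
    have \<psi>_s: "\<psi> s i = \<mu> * \<psi> q i + (1 + \<mu>) * \<psi> y i" for i
      using arg_cong[OF qs, of \<psi>] in_vecs by (simp add: AB_simps fun_eq_iff diff_eq_eq add.commute)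
    define u where "u = vscale X (1 / \<mu>) (vdiff X r x)"
    have "vscale Y (1 / \<mu>) (vdiff Y s y) = vadd Y q y"
      using in_vecs \<mu> by (intro Y.eqI) (simp_all add: AB_simps \<psi>_s field_simps)
    then have "(u, vadd Y q y) \<in> A"
      unfolding u_def using linear_operatorD(4)[OF A linear_operatorD(5)[OF A rs x], of "1 / \<mu>"] by simp
    moreover have "(vadd Y q y, vadd X r b) \<in> B" by (rule linear_operatorD(3)[OF B qr y])
    moreover have "vdiff X (vadd X r b) (vscale X \<mu> u) = f"
      using in_vecs \<mu> by (intro X.eqI) (simp_all add: u_def AB_simps \<phi>_f)
    ultimately show "\<exists>p. p \<in> A O B \<and> vdiff X (snd p) (vscale X \<mu> (fst p)) = f"
      by (intro exI[of _ "(u, vadd X r b)"]) auto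
  next
    fix p p' :: "'a \<times> 'a"
    assume p: "p \<in> A O B \<and> vdiff X (snd p) (vscale X \<mu> (fst p)) = f"
      and p': "p' \<in> A O B \<and> vdiff X (snd p') (vscale X \<mu> (fst p')) = f"
    obtain u e w where pu: "p = (u, w)" "(u, e) \<in> A" "(e, w) \<in> B" using p by (cases p) auto
    obtain u' e' w' where pu': "p' = (u', w')" "(u', e') \<in> A" "(e', w') \<in> B"
      using p' by (cases p') auto
    note in_vecs = A_dom[OF pu(2)] B_dom[OF pu(3)] A_dom[OF pu'(2)] B_dom[OF pu'(3)] f
    have f_eq: "f = vdiff X w (vscale X \<mu> u)" "f = vdiff X w' (vscale X \<mu> u')"
      using p p' by (simp_all add: pu(1) pu'(1))
    have w: "\<phi> w i = \<phi> f i + \<mu> * \<phi> u i" for i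
      by (subst f_eq(1)) (simp add: AB_simps in_vecs)
    have w': "\<phi> w' i = \<phi> f i + \<mu> * \<phi> u' i" for i
      by (subst f_eq(2)) (simp add: AB_simps in_vecs)
    have "vnorm X (vdiff X (vdiff X w w') (vscale X \<mu> (vdiff X u u'))) = 0"
    proof -
      have "\<phi> (vdiff X (vdiff X w w') (vscale X \<mu> (vdiff X u u'))) = (\<lambda>i. 0)"
        using in_vecs by (simp add: AB_simps w w' algebra_simps)
      then show ?thesis
        using in_vecs by (simp add: X.norm_eq X.closed)
    qed
    then have "vnorm X (vdiff X u u') \<le> 0"
      using bound[OF linear_operatorD(5)[OF A pu(2) pu'(2)] linear_operatorD(5)[OF B pu(3) pu'(3)]]
      by simp
    then have "vnorm X (vdiff X u u') = 0"
      using X.norm_nonneg by (rule order_antisym)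
    then have u: "u = u'" using in_vecs(1,5) by (rule X.norm_eq_0_imp_eq[rotated 2])
    have "w = w'" using in_vecs(4,8) by (rule X.eqI) (simp add: w w' u)
    with u show "p = p'" by (simp add: pu pu')
  qed
  then show "\<mu> \<in> resolvent_set X (A O B)"
    unfolding resolvent_set_def using bound by (auto intro!: exI[of _ C'])
qed

section \<open>Direct sums and finitely supported functions\<close>

lemma l2_comp_inj:
  assumes "g \<in> l2" "inj h"
  shows "(\<lambda>x. g (h x)) \<in> l2" "l2_norm (\<lambda>x. g (h x)) \<le> l2_norm g"
proof -
  have "L2_set (\<lambda>x. norm (g (h x))) F \<le> l2_norm g" if "finite F" for F
  proof -
    have "L2_set (\<lambda>x. norm (g (h x))) F = L2_set (\<lambda>x. norm (g x)) (h ` F)"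
      using assms(2) by (simp add: L2_set_def sum.reindex[OF inj_on_subset[OF assms(2)]])
    also have "\<dots> \<le> l2_norm g" using assms(1) that by (intro L2_set_le_l2_norm) auto
    finally show ?thesis .
  qed
  then show "(\<lambda>x. g (h x)) \<in> l2" "l2_norm (\<lambda>x. g (h x)) \<le> l2_norm g"
    using l2_boundedI[of "\<lambda>x. g (h x)" "l2_norm g"] by auto
qed

lemma summable_on_sum_type:
  fixes f :: "'a + 'b \<Rightarrow> 'c::topological_comm_monoid_add"
  assumes "(\<lambda>x. f (Inl x)) summable_on UNIV" "(\<lambda>x. f (Inr x)) summable_on UNIV"
  shows "f summable_on UNIV"
  unfolding UNIV_sum
  by (rule summable_on_Un_disjoint) (use assms in \<open>auto simp: summable_on_reindex o_def\<close>)

lemma infsum_sum_type: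
  fixes f :: "'a + 'b \<Rightarrow> 'c::{topological_comm_monoid_add, t2_space}"
  assumes "(\<lambda>x. f (Inl x)) summable_on UNIV" "(\<lambda>x. f (Inr x)) summable_on UNIV"
  shows "infsum f UNIV = (\<Sum>\<^sub>\<infinity>x. f (Inl x)) + (\<Sum>\<^sub>\<infinity>x. f (Inr x))"
proof -
  have "infsum f UNIV = infsum f (range Inl) + infsum f (range Inr)"
    unfolding UNIV_sum
    by (rule infsum_Un_disjoint) (use assms in \<open>auto simp: summable_on_reindex o_def\<close>)
  then show ?thesis by (simp add: infsum_reindex o_def)
qed

lemma l2_case_sum: "u \<in> l2 \<Longrightarrow> w \<in> l2 \<Longrightarrow> case_sum u w \<in> l2"
  by (simp add: l2_iff summable_on_sum_type)

lemma l2_inner_sum: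
  fixes f g :: "'i + 'j \<Rightarrow> 'k::conj_scalar"
  assumes "f \<in> l2" "g \<in> l2"
  shows "l2_inner f g
       = l2_inner (\<lambda>x. f (Inl x)) (\<lambda>x. g (Inl x)) + l2_inner (\<lambda>x. f (Inr x)) (\<lambda>x. g (Inr x))"
  unfolding l2_inner_def
  using l2_summable[OF l2_comp_inj(1)[OF assms(1) inj_Inl] l2_comp_inj(1)[OF assms(2) inj_Inl]]
    l2_summable[OF l2_comp_inj(1)[OF assms(1) inj_Inr] l2_comp_inj(1)[OF assms(2) inj_Inr]]
  by (rule infsum_sum_type)

lemma l2_inner_finite_support:
  assumes "finite S" "\<And>x. x \<notin> S \<Longrightarrow> v x = 0"
  shows "l2_inner u v = (\<Sum>x\<in>S. conj (u x) * v x)"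
proof -
  have "l2_inner u v = infsum (\<lambda>x. conj (u x) * v x) S"
    unfolding l2_inner_def using assms(2) by (intro infsum_cong_neutral) auto
  then show ?thesis using assms(1) by simp
qed

lemma l2_attains_max:
  assumes "h \<in> l2"
  shows "\<exists>a. \<forall>x. norm (h x) \<le> norm (h a)"
proof (cases "\<forall>x. h x = 0")
  case False
  then obtain b where b: "h b \<noteq> 0" by blast
  define F where "F = {x. norm (h b) \<le> norm (h x)}"
  have "finite F"
  proof (rule ccontr)
    assume inf: "infinite F"
    obtain n where n: "(l2_norm h)\<^sup>2 / (norm (h b))\<^sup>2 < real n" using reals_Archimedean2 by blast
    obtain S where S: "finite S" "card S = n" "S \<subseteq> F" using infinite_arbitrarily_large[OF inf] by blast
    have "real n * (norm (h b))\<^sup>2 \<le> (\<Sum>x\<in>S. (norm (h x))\<^sup>2)"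
      using S sum_bounded_below[of S "(norm (h b))\<^sup>2" "\<lambda>x. (norm (h x))\<^sup>2"]
      by (force simp: F_def intro: power_mono)
    also have "\<dots> = (L2_set (\<lambda>x. norm (h x)) S)\<^sup>2" by (simp add: L2_set_def sum_nonneg)
    also have "\<dots> \<le> (l2_norm h)\<^sup>2" by (intro power_mono L2_set_le_l2_norm assms S) simp
    finally show False using n b by (simp add: field_simps)
  qed
  moreover have "b \<in> F" by (simp add: F_def)
  ultimately have fin: "finite ((\<lambda>x. norm (h x)) ` F)" and ne: "(\<lambda>x. norm (h x)) ` F \<noteq> {}" by auto
  obtain a where "a \<in> F" and a: "norm (h a) = Max ((\<lambda>x. norm (h x)) ` F)"
    using Max_in[OF fin ne] by auto
  have "norm (h x) \<le> norm (h a)" if "x \<in> F" for x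
    unfolding a using that by (intro Max_ge fin) auto
  moreover have "norm (h x) \<le> norm (h a)" if "x \<notin> F" for x
    using that \<open>a \<in> F\<close> by (simp add: F_def)
  ultimately show ?thesis by blast
qed auto

section \<open>The span of the delta functions\<close>

lemma module_pointwise: "module (\<lambda>a u x. a * (u x :: 'k::conj_scalar))"
  by unfold_locales (auto simp: fun_eq_iff algebra_simps)

lemma delta_in_span: "delta x \<in> delta_span"
  unfolding delta_span_def by (intro module.span_base[OF module_pointwise]) simp

lemma delta_span_add: "u \<in> delta_span \<Longrightarrow> v \<in> delta_span \<Longrightarrow> (\<lambda>x. u x + v x) \<in> delta_span"
  using module.span_add[OF module_pointwise, of u _ v] by (simp add: delta_span_def plus_fun_def)

lemma delta_span_scale: "u \<in> delta_span \<Longrightarrow> (\<lambda>x. a * u x) \<in> delta_span"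
  using module.span_scale[OF module_pointwise] by (simp add: delta_span_def)

lemma delta_span_diff: "u \<in> delta_span \<Longrightarrow> v \<in> delta_span \<Longrightarrow> (\<lambda>x. u x - v x) \<in> delta_span"
  using delta_span_add[of u "\<lambda>x. (- 1) * v x"] delta_span_scale[of v "- 1"] by simp

lemma delta_span_induct [consumes 1, case_names zero add scale delta]:
  assumes "u \<in> delta_span"
    and "P (\<lambda>x. 0)" "\<And>u v. P u \<Longrightarrow> P v \<Longrightarrow> P (\<lambda>x. u x + v x)" "\<And>a u. P u \<Longrightarrow> P (\<lambda>x. a * u x)"
    and "\<And>v. P (delta v)"
  shows "P u"
proof (rule module.span_induct[OF module_pointwise, where P = P and S = "range delta"])
  show "u \<in> module.span (\<lambda>a u x. a * u x) (range delta)"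
    using assms(1) by (simp add: delta_span_def)
  show "module.subspace (\<lambda>a u x. a * u x) (Collect P)"
    using assms(2-4) by (simp add: module.subspace_def[OF module_pointwise] zero_fun_def plus_fun_def)
qed (use assms(5) in auto)

lemma l2_delta: "delta v \<in> l2"
  by (rule l2_finite_support) (simp add: delta_def)

lemma l2_delta_span: "u \<in> delta_span \<Longrightarrow> u \<in> l2"
  by (induction rule: delta_span_induct) (auto intro: l2_triangle l2_scale l2_delta l2_finite_support)

lemma l2_inner_delta: "l2_inner u (delta v) = conj (u v)"
  by (subst l2_inner_finite_support[of "{v}"]) (auto simp: delta_def)

section \<open>Gradient and Laplacian\<close>

text \<open>The weighted gradient, normalised such that the energy form is its inner product.\<close>

definition grad :: "('v \<Rightarrow> 'v \<Rightarrow> real) \<Rightarrow> ('v \<Rightarrow> 'k::conj_scalar) \<Rightarrow> 'v \<times> 'v \<Rightarrow> 'k" where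
  "grad c u = (\<lambda>(x, y). of_real (sqrt (c x y / 2)) * (u x - u y))"

lemma grad_add: "grad c (\<lambda>x. u x + v x) = (\<lambda>p. grad c u p + grad c v p)"
  by (auto simp: grad_def algebra_simps)

lemma grad_diff: "grad c (\<lambda>x. u x - v x) = (\<lambda>p. grad c u p - grad c v p)"
  by (auto simp: grad_def algebra_simps)

lemma grad_scale: "grad c (\<lambda>x. a * u x) = (\<lambda>p. a * grad c u p)"
  by (auto simp: grad_def algebra_simps)

lemma laplacian_add: "laplacian c (\<lambda>x. u x + v x) = (\<lambda>x. laplacian c u x + laplacian c v x)"
  by (simp add: laplacian_def algebra_simps sum.distrib sum_subtractf fun_eq_iff)

lemma laplacian_diff: "laplacian c (\<lambda>x. u x - v x) = (\<lambda>x. laplacian c u x - laplacian c v x)"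
  by (simp add: laplacian_def algebra_simps sum.distrib sum_subtractf fun_eq_iff)

lemma laplacian_scale: "laplacian c (\<lambda>x. a * u x) = (\<lambda>x. a * laplacian c u x)"
  by (auto simp: laplacian_def algebra_simps sum_distrib_left)

lemma laplacian_add_const: "laplacian c (\<lambda>x. u x + a) = laplacian c u"
  by (simp add: laplacian_def fun_eq_iff)

lemma laplacian_zero [simp]: "laplacian c (\<lambda>x. 0) = (\<lambda>x. 0)"
  by (simp add: laplacian_def fun_eq_iff)

lemma laplacian_tendsto:
  assumes "\<And>x. (\<lambda>n. X n x) \<longlonglongrightarrow> u x"
  shows "(\<lambda>n. laplacian c (X n) x) \<longlonglongrightarrow> laplacian c u x"
  unfolding laplacian_def by (intro tendsto_intros assms)

context network
begin

lemma grad_l2_iff: "grad c u \<in> l2 \<longleftrightarrow> u \<in> dom_energy c"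
proof -
  have "(norm (grad c u p))\<^sup>2 = (1 / 2) * (case p of (x, y) \<Rightarrow> c x y * (norm (u x - u y))\<^sup>2)" for p
    by (cases p) (simp add: grad_def norm_mult power_mult_distrib conductance_nonneg)
  then show ?thesis
    unfolding l2_iff dom_energy_def mem_Collect_eq
    by (simp only: summable_on_cmult_right')
qed

lemma energy_eq_inner: "energy c u v = l2_inner (grad c u) (grad c v)"
proof -
  have "conj (grad c u p) * grad c v p
      = (case p of (x, y) \<Rightarrow> of_real (c x y) * (conj (u x - u y) * (v x - v y))) * (1 / 2)" for p
  proof (cases p)
    case (Pair x y)
    define s where "s = sqrt (c x y / 2)"
    have "s * s = c x y / 2" by (simp add: s_def conductance_nonneg)
    then have "of_real s * of_real s = (of_real (c x y) / 2 :: 'a)"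
      by (metis of_real_divide of_real_mult of_real_numeral)
    moreover have "conj (of_real s * a) * (of_real s * b) = (of_real s * of_real s) * (conj a * b)" for a b :: 'a
      by (simp add: conj_mult conj_of_real)
    ultimately show ?thesis by (simp only: Pair grad_def prod.case s_def[symmetric]) simp
  qed
  then show ?thesis
    unfolding energy_def l2_inner_def by (simp only: infsum_cmult_left') simp
qed

lemma dom_energy_add: "u \<in> dom_energy c \<Longrightarrow> v \<in> dom_energy c \<Longrightarrow> (\<lambda>x. u x + v x) \<in> dom_energy c"
  by (simp add: grad_l2_iff[symmetric] grad_add l2_triangle)

lemma dom_energy_diff: "u \<in> dom_energy c \<Longrightarrow> v \<in> dom_energy c \<Longrightarrow> (\<lambda>x. u x - v x) \<in> dom_energy c"
  by (simp add: grad_l2_iff[symmetric] grad_diff l2_diff)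

lemma dom_energy_scale: "u \<in> dom_energy c \<Longrightarrow> (\<lambda>x. a * u x) \<in> dom_energy c"
  by (simp add: grad_l2_iff[symmetric] grad_scale l2_scale)

text \<open>By connectedness, a function is determined by its gradient up to a constant.\<close>

lemma grad_eqD:
  assumes "grad c u = grad c v"
  obtains a where "\<And>x. v x = u x + a"
proof -
  have edge: "v x - u x = v y - u y" if "c x y > 0" for x y
  proof -
    have "u x - u y = v x - v y"
      using fun_cong[OF assms, of "(x, y)"] that by (simp add: grad_def)
    then show ?thesis by (simp add: algebra_simps)
  qed
  have "v x - u x = v y - u y" for x y
    using connected[of x y] by (induction rule: rtrancl_induct) (auto dest: edge)
  then have "v x = u x + (v undefined - u undefined)" for x by (metis add_diff_cancel_left' diff_add_cancel add.commute)
  then show thesis by (rule that)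
qed

lemma neighbour_not_self: "c x y > 0 \<Longrightarrow> x \<noteq> y"
  using conductance_refl by auto

lemma conj_laplacian: "conj (laplacian c u x) = (\<Sum>y | c x y > 0. of_real (c x y) * conj (u x - u y))"
  by (simp add: laplacian_def conj_sum conj_mult conj_of_real)

lemma grad_delta_support:
  assumes "p \<notin> Pair v ` {y. c v y > 0} \<union> (\<lambda>y. (y, v)) ` {y. c v y > 0}"
  shows "grad c (delta v) p = 0"
proof (cases p)
  case (Pair x y)
  consider "x = y" | "x \<noteq> v" "y \<noteq> v" | "x = v \<or> y = v" "\<not> c x y > 0"
    using assms Pair conductance_sym by fastforce
  then show ?thesis
  proof cases
    case 3
    then have "c x y = 0" using conductance_nonneg[of x y] by linarith
    then show ?thesis by (simp add: Pair grad_def)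
  qed (auto simp: Pair grad_def delta_def)
qed

lemma dom_energy_delta: "delta v \<in> dom_energy c"
proof -
  have "{p. grad c (delta v) p \<noteq> 0} \<subseteq> Pair v ` {y. c v y > 0} \<union> (\<lambda>y. (y, v)) ` {y. c v y > 0}"
    using grad_delta_support by blast
  then have "finite {p. grad c (delta v) p \<noteq> 0}"
    by (rule finite_subset) (simp add: locally_finite)
  then show ?thesis unfolding grad_l2_iff[symmetric] by (rule l2_finite_support)
qed

lemma grad_inner_delta: "l2_inner (grad c w) (grad c (delta v)) = conj (laplacian c w v)"
proof -
  define N where "N = {y. c v y > 0}"
  have N: "finite N" "v \<notin> N" using locally_finite neighbour_not_self by (auto simp: N_def)
  have half: "conj (grad c w (v, y)) * grad c (delta v) (v, y)
      = of_real (c v y) * conj (w v - w y) / 2"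
    "conj (grad c w (y, v)) * grad c (delta v) (y, v)
      = of_real (c v y) * conj (w v - w y) / 2" if "y \<in> N" for y
  proof -
    define s where "s = sqrt (c v y / 2)"
    have "s * s = c v y / 2" by (simp add: s_def conductance_nonneg)
    then have s: "of_real s * of_real s = (of_real (c v y) / 2 :: 'a)"
      by (metis of_real_divide of_real_mult of_real_numeral)
    have "v \<noteq> y" using N that by auto
    have "conj (grad c w (v, y)) * grad c (delta v) (v, y) = (of_real s * of_real s) * conj (w v - w y)"
      using \<open>v \<noteq> y\<close> by (simp add: grad_def delta_def s_def[symmetric] conj_mult conj_of_real)
    moreover have "conj (grad c w (y, v)) * grad c (delta v) (y, v) = (of_real s * of_real s) * conj (w v - w y)"
      using \<open>v \<noteq> y\<close> by (simp add: grad_def delta_def conductance_sym[of y v] s_def[symmetric]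
          conj_mult conj_of_real conj_diff algebra_simps)
    ultimately show "conj (grad c w (v, y)) * grad c (delta v) (v, y)
      = of_real (c v y) * conj (w v - w y) / 2"
    "conj (grad c w (y, v)) * grad c (delta v) (y, v)
      = of_real (c v y) * conj (w v - w y) / 2" by (simp_all add: s)
  qed
  have "l2_inner (grad c w) (grad c (delta v))
      = (\<Sum>p\<in>Pair v ` N \<union> (\<lambda>y. (y, v)) ` N. conj (grad c w p) * grad c (delta v) p)"
    using N(1) grad_delta_support[of _ v] unfolding N_def[symmetric]
    by (intro l2_inner_finite_support) auto
  also have "\<dots> = (\<Sum>p\<in>Pair v ` N. conj (grad c w p) * grad c (delta v) p)
      + (\<Sum>p\<in>(\<lambda>y. (y, v)) ` N. conj (grad c w p) * grad c (delta v) p)"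
    using N by (intro sum.union_disjoint) auto
  also have "\<dots> = (\<Sum>y\<in>N. of_real (c v y) * conj (w v - w y) / 2)
      + (\<Sum>y\<in>N. of_real (c v y) * conj (w v - w y) / 2)"
    by (simp add: sum.reindex inj_on_def half)
  also have "\<dots> = conj (laplacian c w v)"
    by (simp add: sum.distrib[symmetric] conj_laplacian N_def)
  finally show ?thesis .
qed

lemma laplacian_delta:
  assumes "x \<noteq> v" shows "laplacian c (delta v) x = - of_real (c v x)"
proof -
  have "laplacian c (delta v) x = (\<Sum>y | c x y > 0. if y = v then - of_real (c x v) else 0)"
    unfolding laplacian_def using assms by (intro sum.cong) (auto simp: delta_def)
  also have "\<dots> = (if c x v > 0 then - of_real (c x v) else 0)"
    by (simp add: sum.delta' locally_finite)
  also have "\<dots> = - of_real (c v x)"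
    using conductance_nonneg[of x v] by (auto simp: conductance_sym[of v x])
  finally show ?thesis .
qed

lemma laplacian_delta_support: "x \<notin> insert v {y. c v y > 0} \<Longrightarrow> laplacian c (delta v) x = 0"
  using laplacian_delta[of x v] conductance_nonneg[of v x] by auto

lemma l2_laplacian_delta: "laplacian c (delta v) \<in> l2"
proof (rule l2_finite_support)
  have "{x. laplacian c (delta v) x \<noteq> 0} \<subseteq> insert v {y. c v y > 0}"
    using laplacian_delta_support by blast
  then show "finite {x. laplacian c (delta v) x \<noteq> 0}"
    by (rule finite_subset) (simp add: locally_finite)
qed

lemma inner_laplacian_delta: "l2_inner h (laplacian c (delta v)) = conj (laplacian c h v)"
proof -
  define N where "N = {y. c v y > 0}"
  have N: "finite N" "v \<notin> N" using locally_finite neighbour_not_self by (auto simp: N_def)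
  have self: "laplacian c (delta v) v = (\<Sum>y\<in>N. of_real (c v y))"
    unfolding laplacian_def N_def[symmetric] using N by (intro sum.cong) (auto simp: delta_def)
  have neighbours: "(\<Sum>x\<in>N. conj (h x) * laplacian c (delta v) x)
      = (\<Sum>x\<in>N. conj (h x) * (- of_real (c v x)))"
  proof (intro sum.cong refl)
    fix x assume "x \<in> N"
    then have "x \<noteq> v" using N by auto
    then show "conj (h x) * laplacian c (delta v) x = conj (h x) * (- of_real (c v x))"
      by (simp add: laplacian_delta)
  qed
  have "l2_inner h (laplacian c (delta v))
      = (\<Sum>x\<in>insert v N. conj (h x) * laplacian c (delta v) x)"
    using laplacian_delta_support[of _ v] N(1) unfolding N_def[symmetric]
    by (intro l2_inner_finite_support) auto
  also have "\<dots> = conj (h v) * (\<Sum>x\<in>N. of_real (c v x)) + (\<Sum>x\<in>N. conj (h x) * (- of_real (c v x)))"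
    unfolding sum.insert[OF N] self neighbours by (rule refl)
  also have "\<dots> = conj (laplacian c h v)"
    by (simp add: conj_laplacian N_def[symmetric] conj_diff right_diff_distrib sum_subtractf
        sum_distrib_left sum_negf mult.commute)
  finally show ?thesis .
qed

text \<open>
  The maximum principle: the equation gives \<open>(1 + \<Sum>\<^sub>y c\<^bsub>xy\<^esub>) \<bar>h x\<bar> \<le> \<Sum>\<^sub>y c\<^bsub>xy\<^esub> \<bar>h y\<bar>\<close>, which forces
  \<open>h x = 0\<close> at a point \<open>x\<close> where \<open>\<bar>h\<bar>\<close> is maximal. Square-summability guarantees that the maximum is attained.
\<close>

lemma laplacian_eq_minus_imp_zero:
  assumes "h \<in> l2" and eq: "\<And>x. laplacian c h x = - h x"
  shows "h x = 0"
proof -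
  obtain a where max: "\<And>x. norm (h x) \<le> norm (h a)" using l2_attains_max[OF assms(1)] by blast
  define N where "N = {y. c a y > 0}"
  define d where "d = (\<Sum>y\<in>N. c a y)"
  have d: "0 \<le> d" unfolding d_def by (intro sum_nonneg conductance_nonneg)
  have "laplacian c h a = of_real d * h a - (\<Sum>y\<in>N. of_real (c a y) * h y)"
    by (simp add: laplacian_def N_def[symmetric] d_def right_diff_distrib sum_subtractf sum_distrib_right)
  then have "of_real (d + 1) * h a = (\<Sum>y\<in>N. of_real (c a y) * h y)"
    using eq[of a] by (simp add: algebra_simps)
  then have "norm (of_real (d + 1) * h a) = norm (\<Sum>y\<in>N. of_real (c a y) * h y)" by simp
  also have "\<dots> \<le> (\<Sum>y\<in>N. c a y * norm (h a))"
    by (intro sum_norm_le) (simp add: norm_mult conductance_nonneg mult_left_mono max)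
  also have "\<dots> = d * norm (h a)" by (simp add: d_def sum_distrib_right)
  finally have "(d + 1) * norm (h a) \<le> d * norm (h a)" using d by (simp add: norm_mult del: of_real_add)
  then have "norm (h a) \<le> 0" by (simp add: distrib_right)
  then show ?thesis using max[of x] by simp
qed

section \<open>The energy space\<close>

lemma energy_space_vecs: "A \<in> vecs (energy_space c) \<longleftrightarrow> (\<exists>u \<in> dom_energy c. A = energy_class c u)"
  by (auto simp: energy_space_def quotient_def energy_class_def)

lemma energy_class_in_vecs: "u \<in> dom_energy c \<Longrightarrow> energy_class c u \<in> vecs (energy_space c)"
  by (auto simp: energy_space_vecs)

lemma grad_rep: "u \<in> dom_energy c \<Longrightarrow> grad c (rep (energy_class c u)) = grad c u"
  using rep_energy_class[of u c] by (auto simp: const_rel_def grad_def)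

lemma energy_class_eqI:
  assumes "grad c u = grad c v" shows "energy_class c u = energy_class c v"
proof -
  obtain a where "\<And>x. v x = u x + a" using grad_eqD[OF assms] by blast
  then have "v = (\<lambda>x. u x + a)" by blast
  then show ?thesis by (simp add: energy_class_add_const)
qed

lemma l2_coordinates_energy_space:
  "l2_coordinates (energy_space c :: ('k::conj_scalar, _) inner_space) (\<lambda>A. grad c (rep A))"
proof
  let ?H = "energy_space c :: ('k, ('v \<Rightarrow> 'k) set) inner_space"
  show "inj_on (\<lambda>A. grad c (rep A)) (vecs ?H)"
  proof (rule inj_onI)
    fix A B assume "A \<in> vecs ?H" "B \<in> vecs ?H" and eq: "grad c (rep A) = grad c (rep B)"
    then obtain u v where "u \<in> dom_energy c" "A = energy_class c u"
      "v \<in> dom_energy c" "B = energy_class c v" by (auto simp: energy_space_vecs)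
    with eq show "A = B" by (simp add: grad_rep energy_class_eqI[of u v])
  qed
  fix A B :: "('v \<Rightarrow> 'k) set" and a :: 'k
  assume "A \<in> vecs ?H"
  then obtain u where u: "u \<in> dom_energy c" "A = energy_class c u" by (auto simp: energy_space_vecs)
  show "grad c (rep A) \<in> l2" using u by (simp add: grad_rep grad_l2_iff)
  show "vscale ?H a A \<in> vecs ?H" "grad c (rep (vscale ?H a A)) = (\<lambda>p. a * grad c (rep A) p)"
    using u by (simp_all add: vscale_energy_class energy_class_in_vecs dom_energy_scale grad_rep grad_scale)
  assume "B \<in> vecs ?H"
  then obtain v where v: "v \<in> dom_energy c" "B = energy_class c v" by (auto simp: energy_space_vecs)
  show "vadd ?H A B \<in> vecs ?H"
    "grad c (rep (vadd ?H A B)) = (\<lambda>p. grad c (rep A) p + grad c (rep B) p)"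
    using u v by (simp_all add: vadd_energy_class energy_class_in_vecs dom_energy_add grad_rep grad_add)
  show "vinner ?H A B = l2_inner (grad c (rep A)) (grad c (rep B))"
    using u v by (simp add: vinner_energy_class energy_eq_inner grad_rep)
qed

lemma inner_energy_class:
  "u \<in> dom_energy c \<Longrightarrow> v \<in> dom_energy c \<Longrightarrow>
    vinner (energy_space c) (energy_class c u) (energy_class c v) = l2_inner (grad c u) (grad c v)"
  by (simp add: vinner_energy_class energy_eq_inner)

lemma converges_energy_class:
  assumes "\<And>n. X n \<in> dom_energy c" "u \<in> dom_energy c"
  shows "vconverges (energy_space c) (\<lambda>n. energy_class c (X n)) (energy_class c u)
     \<longleftrightarrow> vconverges l2_space (\<lambda>n. grad c (X n)) (grad c u)"
  by (subst l2_coordinates.converges_iff[OF l2_coordinates_energy_space])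
     (simp_all add: energy_class_in_vecs assms grad_rep)

section \<open>The inclusion operator and its adjoint\<close>

lemma dom_energy_delta_span: "u \<in> delta_span \<Longrightarrow> u \<in> dom_energy c"
proof (induction rule: delta_span_induct)
  case zero
  then show ?case using dom_energy_scale[OF dom_energy_delta, of 0] by simp
qed (auto intro: dom_energy_add dom_energy_scale dom_energy_delta)

lemma l2_laplacian_delta_span: "u \<in> delta_span \<Longrightarrow> laplacian c u \<in> l2"
proof (induction rule: delta_span_induct)
  case zero
  then show ?case by (simp add: l2_finite_support)
qed (auto simp: laplacian_add laplacian_scale intro: l2_triangle l2_scale l2_laplacian_delta)

text \<open>The Gauss--Green formula, in which one of the two functions has finite support.\<close>

lemma grad_inner_delta_span:
  assumes "w \<in> dom_energy c" "laplacian c w \<in> l2" "u \<in> delta_span"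
  shows "l2_inner (grad c w) (grad c u) = l2_inner (laplacian c w) u"
proof -
  have w: "grad c w \<in> l2" using assms by (simp add: grad_l2_iff)
  have "u \<in> l2 \<and> grad c u \<in> l2 \<and> l2_inner (grad c w) (grad c u) = l2_inner (laplacian c w) u"
    using assms(3)
  proof (induction rule: delta_span_induct)
    case zero
    have "(\<lambda>x. 0 :: 'a) \<in> l2" "grad c (\<lambda>x. 0 :: 'a) = (\<lambda>p. 0)"
      by (auto simp: grad_def intro: l2_finite_support)
    moreover from this have "grad c (\<lambda>x. 0 :: 'a) \<in> l2" by (simp add: l2_finite_support)
    ultimately show ?case by (simp add: l2_inner_def)
  next
    case (add u v)
    then show ?case
      using w assms(2) by (simp add: grad_add l2_inner_add_right l2_triangle)
  next
    case (scale a u)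
    then show ?case by (simp add: grad_scale l2_inner_scale_right l2_scale)
  next
    case (delta v)
    show ?case
      by (simp add: l2_delta grad_l2_iff dom_energy_delta grad_inner_delta l2_inner_delta)
  qed
  then show ?thesis by simp
qed

text \<open>Closability of the inclusion: limits in the two norms agree up to a constant.\<close>

lemma inclusionD:
  assumes "(x, A) \<in> inclusion c"
  shows "x \<in> l2" "x \<in> dom_energy c" "A = energy_class c x"
proof -
  obtain X where x: "x \<in> l2" and A: "A \<in> vecs (energy_space c)"
    and X: "\<And>n. X n \<in> delta_span" "vconverges l2_space X x"
      "vconverges (energy_space c) (\<lambda>n. energy_class c (X n)) A"
  proof -
    obtain X Y where *: "x \<in> l2" "A \<in> vecs (energy_space c)"
      "\<And>n. (X n, Y n) \<in> {(u, energy_class c u) | u. u \<in> delta_span}"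
      "vconverges l2_space X x" "vconverges (energy_space c) Y A"
      using assms by (auto simp: inclusion_def op_closure_def)
    have "Y = (\<lambda>n. energy_class c (X n))" using *(3) by auto
    with * show thesis by (intro that[of X]) auto
  qed
  obtain v where v: "v \<in> dom_energy c" "A = energy_class c v" using A by (auto simp: energy_space_vecs)
  have "vconverges l2_space (\<lambda>n. grad c (X n)) (grad c v)"
    using X(3) v by (simp add: converges_energy_class dom_energy_delta_span X)
  then have *: "(\<lambda>n. grad c (X n) p) \<longlonglongrightarrow> grad c v p" for p
    using v by (intro l2_pointwise_tendsto) (simp_all add: grad_l2_iff dom_energy_delta_span X)
  have "(\<lambda>n. X n z) \<longlonglongrightarrow> x z" for z
    by (intro l2_pointwise_tendsto) (simp_all add: l2_delta_span X x)
  then have "(\<lambda>n. grad c (X n) p) \<longlonglongrightarrow> grad c x p" for p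
    unfolding grad_def by (cases p) (auto intro!: tendsto_intros)
  then have "grad c x p = grad c v p" for p
    using * LIMSEQ_unique by blast
  then have eq: "grad c x = grad c v" by blast
  then show "x \<in> dom_energy c" using v by (simp flip: grad_l2_iff)
  show "A = energy_class c x" using v energy_class_eqI[OF eq] by simp
  show "x \<in> l2" by fact
qed

lemma inclusionI:
  assumes "\<And>n. X n \<in> delta_span" "x \<in> l2" "vconverges l2_space X x" "x \<in> dom_energy c"
    and "vconverges l2_space (\<lambda>n. grad c (X n)) (grad c x)"
  shows "(x, energy_class c x) \<in> inclusion c"
  unfolding inclusion_def op_closure_def
  using assms
  by (auto simp: energy_class_in_vecs converges_energy_class dom_energy_delta_span
      intro!: exI[of _ X] exI[of _ "\<lambda>n. energy_class c (X n)"])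

lemma linear_inclusion:
  "linear_operator l2_space (energy_space c :: ('k::conj_scalar, _) inner_space) (inclusion c)"
  unfolding inclusion_def
proof (rule linear_operator_op_closure[OF l2_coordinates_l2_space l2_coordinates_energy_space])
  show "linear_operator l2_space (energy_space c :: ('k, _) inner_space)
      {(u, energy_class c u) | u. u \<in> delta_span}"
    unfolding linear_operator_def
    by (auto simp: l2_delta_span energy_class_in_vecs dom_energy_delta_span
        vadd_energy_class vscale_energy_class delta_span_add delta_span_scale)
qed

lemma inclusion_delta_span:
  assumes "u \<in> delta_span" shows "(u, energy_class c u) \<in> inclusion c"
proof (rule inclusionI)
  show "vconverges l2_space (\<lambda>n. u) u" "vconverges l2_space (\<lambda>n. grad c u) (grad c u)"
    by (simp_all add: vconverges_l2)
qed (use assms in \<open>auto simp: l2_delta_span dom_energy_delta_span\<close>)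

text \<open>
  The adjoint of the inclusion sends the class of \<open>u\<close> to \<open>\<Delta> u\<close>, and its domain consists of all classes
  for which this function is square-summable.
\<close>

lemma inclusion_adjointI:
  assumes u: "u \<in> dom_energy c" and lap: "laplacian c u \<in> l2"
  shows "(energy_class c u, laplacian c u) \<in> op_adjoint l2_space (energy_space c) (inclusion c)"
proof -
  have "vinner (energy_space c) (energy_class c u) A = l2_inner (laplacian c u) x"
    if xA: "(x, A) \<in> inclusion c" for x A
  proof -
    obtain X where X: "\<And>n. X n \<in> delta_span" "vconverges l2_space X x"
      "vconverges (energy_space c) (\<lambda>n. energy_class c (X n)) A"
    proof -
      obtain X Y where *: "\<And>n. (X n, Y n) \<in> {(u, energy_class c u) | u. u \<in> delta_span}"
        "vconverges l2_space X x" "vconverges (energy_space c) Y A"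
        using xA by (auto simp: inclusion_def op_closure_def)
      have "Y = (\<lambda>n. energy_class c (X n))" using *(1) by auto
      with * show thesis by (intro that[of X]) auto
    qed
    have "(\<lambda>n. vinner (energy_space c) (energy_class c u) (energy_class c (X n)))
        \<longlonglongrightarrow> vinner (energy_space c) (energy_class c u) A"
      using X(3) u inclusionD[OF xA]
      by (intro l2_coordinates.inner_tendsto[OF l2_coordinates_energy_space])
         (simp_all add: energy_class_in_vecs dom_energy_delta_span X)
    moreover have "(\<lambda>n. l2_inner (laplacian c u) (X n)) \<longlonglongrightarrow> l2_inner (laplacian c u) x"
      using X(2) inclusionD[OF xA] lap by (intro l2_inner_tendsto) (simp_all add: l2_delta_span X)
    moreover have "vinner (energy_space c) (energy_class c u) (energy_class c (X n))
        = l2_inner (laplacian c u) (X n)" for n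
      by (simp add: inner_energy_class grad_inner_delta_span u lap X dom_energy_delta_span)
    ultimately show ?thesis using LIMSEQ_unique by fastforce
  qed
  then show ?thesis
    using u lap by (auto simp: op_adjoint_def energy_class_in_vecs)
qed

lemma inclusion_adjointD:
  assumes "(A, z) \<in> op_adjoint l2_space (energy_space c) (inclusion c)"
  obtains u where "u \<in> dom_energy c" "A = energy_class c u" "z = laplacian c u"
proof -
  obtain u where u: "u \<in> dom_energy c" "A = energy_class c u"
    using assms by (auto simp: op_adjoint_def energy_space_vecs)
  have "z v = laplacian c u v" for v
  proof -
    have "vinner (energy_space c) A (energy_class c (delta v)) = l2_inner z (delta v)"
      using assms inclusion_delta_span[OF delta_in_span[of v]] unfolding op_adjoint_def by blast
    then show ?thesis
      using u by (simp add: inner_energy_class dom_energy_delta grad_inner_delta l2_inner_delta)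
  qed
  then have "z = laplacian c u" by blast
  with u show thesis by (rule that)
qed

section \<open>Solvability of the shifted equations\<close>

text \<open>
  The pair of \<open>f\<close> and the class of \<open>z\<close> is projected onto the graph of the inclusion \<open>J\<close>. For \<open>z = 0\<close> the
  projection solves \<open>(J\<^sup>* J + 1) x = f\<close>, and for \<open>f = 0\<close> the residual \<open>z - x\<close> solves
  \<open>(J J\<^sup>* + 1) (z - x) = z\<close>.
\<close>

lemma inclusion_graph_projection:
  fixes f z :: "'v \<Rightarrow> 'k::conj_scalar"
  assumes f: "f \<in> l2" and z: "z \<in> dom_energy c"
  obtains x where "(x, energy_class c x) \<in> inclusion c"
    "\<And>v. laplacian c (\<lambda>i. z i - x i) v = x v - f v"
proof -
  \<comment> \<open>\<open>T u\<close> represents the point of the graph over \<open>u\<close> as a function on a disjoint sum.\<close>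
  define T where "T u = case_sum u (grad c u)" for u :: "'v \<Rightarrow> 'k"
  define F where "F = case_sum f (grad c z)"
  have T_l2: "T u \<in> l2" if "u \<in> delta_span" for u
    unfolding T_def using that by (intro l2_case_sum) (simp_all add: l2_delta_span grad_l2_iff dom_energy_delta_span)
  have F_l2: "F \<in> l2" unfolding F_def using f z by (intro l2_case_sum) (simp_all add: grad_l2_iff)
  have T_add: "(\<lambda>i. T u i + T v i) = T (\<lambda>i. u i + v i)" for u v
    by (auto simp: T_def grad_add fun_eq_iff split: sum.splits)
  have T_scale: "(\<lambda>i. a * T u i) = T (\<lambda>i. a * u i)" for a u
    by (auto simp: T_def grad_scale fun_eq_iff split: sum.splits)
  obtain Y g where Y: "\<And>n. Y n \<in> T ` delta_span" and g: "g \<in> l2" and lim: "vconverges l2_space Y g"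
    and orth: "\<And>s. s \<in> T ` delta_span \<Longrightarrow> l2_inner (\<lambda>i. g i - F i) s = 0"
  proof (rule l2_projection[of "T ` delta_span" F])
    show "T ` delta_span \<noteq> {}" using delta_in_span[of undefined] by auto
    show "\<And>u v. u \<in> T ` delta_span \<Longrightarrow> v \<in> T ` delta_span \<Longrightarrow> (\<lambda>x. u x + v x) \<in> T ` delta_span"
      by (auto simp: T_add intro!: imageI delta_span_add)
    show "\<And>a u. u \<in> T ` delta_span \<Longrightarrow> (\<lambda>x. a * u x) \<in> T ` delta_span"
      by (auto simp: T_scale intro!: imageI delta_span_scale)
  qed (use T_l2 F_l2 in auto)
  have "\<forall>n. \<exists>u. u \<in> delta_span \<and> Y n = T u" using Y by auto
  from choice[OF this] obtain X where X: "\<And>n. X n \<in> delta_span" "\<And>n. Y n = T (X n)" by auto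
  define x where "x v = g (Inl v)" for v
  have Y_l2: "Y n \<in> l2" for n by (simp add: X T_l2)
  have pointwise: "(\<lambda>n. Y n i) \<longlonglongrightarrow> g i" for i by (intro l2_pointwise_tendsto Y_l2 g lim)
  have "(\<lambda>n. X n v) \<longlonglongrightarrow> x v" for v
    using pointwise[of "Inl v"] by (simp add: X T_def x_def)
  then have "(\<lambda>n. grad c (X n) p) \<longlonglongrightarrow> grad c x p" for p
    unfolding grad_def by (cases p) (auto intro!: tendsto_intros)
  moreover have "(\<lambda>n. grad c (X n) p) \<longlonglongrightarrow> g (Inr p)" for p
    using pointwise[of "Inr p"] by (simp add: X T_def)
  ultimately have grad_x: "g (Inr p) = grad c x p" for p using LIMSEQ_unique by blast
  have x_l2: "x \<in> l2" using l2_comp_inj(1)[OF g inj_Inl] by (simp add: x_def[abs_def])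
  have x_dom: "x \<in> dom_energy c"
    using l2_comp_inj(1)[OF g inj_Inr] by (simp add: grad_x flip: grad_l2_iff)
  have diff_l2: "(\<lambda>i. Y n i - g i) \<in> l2" for n by (intro l2_diff Y_l2 g)
  have norms: "(\<lambda>n. l2_norm (\<lambda>i. Y n i - g i)) \<longlonglongrightarrow> 0" using lim by (simp add: vconverges_l2)
  have "(x, energy_class c x) \<in> inclusion c"
  proof (rule inclusionI[OF X(1) x_l2 _ x_dom])
    show "vconverges l2_space X x"
      unfolding vconverges_l2
      using l2_comp_inj(2)[OF diff_l2 inj_Inl]
      by (intro tendsto_0_le[where K=1, OF norms]) (simp add: X T_def x_def)
    show "vconverges l2_space (\<lambda>n. grad c (X n)) (grad c x)"
      unfolding vconverges_l2
      using l2_comp_inj(2)[OF diff_l2 inj_Inr]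
      by (intro tendsto_0_le[where K=1, OF norms]) (simp add: X T_def grad_x)
  qed
  moreover have "laplacian c (\<lambda>i. z i - x i) v = x v - f v" for v
  proof -
    have "0 = l2_inner (\<lambda>i. g i - F i) (T (delta v))"
      using orth[OF imageI[OF delta_in_span]] by simp
    also have "\<dots> = l2_inner (\<lambda>i. x i - f i) (delta v) + l2_inner (grad c (\<lambda>i. x i - z i)) (grad c (delta v))"
      by (subst l2_inner_sum[OF l2_diff[OF g F_l2] T_l2[OF delta_in_span]])
         (simp add: T_def F_def grad_x grad_diff flip: x_def)
    also have "\<dots> = conj (x v - f v + laplacian c (\<lambda>i. x i - z i) v)"
      by (simp add: l2_inner_delta grad_inner_delta conj_add)
    finally have "x v - f v + laplacian c (\<lambda>i. x i - z i) v = 0" by (metis conj_0 conj_conj)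
    then show ?thesis by (simp add: laplacian_diff algebra_simps eq_neg_iff_add_eq_0)
  qed
  ultimately show thesis by (rule that)
qed

lemma l2_norm_le_laplacian_plus_one:
  assumes "u \<in> delta_span"
  shows "l2_norm u \<le> l2_norm (\<lambda>x. laplacian c u x + u x)"
proof -
  let ?g = "\<lambda>x. laplacian c u x + u x"
  have l2: "u \<in> l2" "laplacian c u \<in> l2" and dom: "u \<in> dom_energy c"
    using assms by (simp_all add: l2_delta_span l2_laplacian_delta_span dom_energy_delta_span)
  have "l2_inner ?g u = l2_inner (grad c u) (grad c u) + l2_inner u u"
    using l2 dom assms by (simp add: l2_inner_add_left grad_inner_delta_span)
  also have "\<dots> = of_real ((l2_norm (grad c u))\<^sup>2 + (l2_norm u)\<^sup>2)"
    using l2 dom by (simp add: l2_inner_self grad_l2_iff)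
  finally have "norm (l2_inner ?g u) = (l2_norm (grad c u))\<^sup>2 + (l2_norm u)\<^sup>2"
    by (simp only: norm_of_real) simp
  then have "(l2_norm (grad c u))\<^sup>2 + (l2_norm u)\<^sup>2 \<le> l2_norm ?g * l2_norm u"
    using Cauchy_Schwarz_l2[of ?g u] l2 by (simp add: l2_triangle)
  then have "(l2_norm u)\<^sup>2 \<le> l2_norm ?g * l2_norm u"
    using zero_le_power2[of "l2_norm (grad c u)"] by linarith
  then have "l2_norm u * l2_norm u \<le> l2_norm ?g * l2_norm u" by (simp only: power2_eq_square)
  then show ?thesis
    using l2_norm_nonneg[of u] l2_norm_nonneg[of ?g] mult_right_le_imp_le[of "l2_norm u"]
    by (cases "0 < l2_norm u") (blast, linarith)
qed

text \<open>
  The range of \<open>\<Delta> + 1\<close> on finitely supported functions is dense, because a function orthogonal to it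
  vanishes by the maximum principle; since \<open>\<Delta> + 1\<close> is bounded below, its closure is surjective.
\<close>

lemma l2_laplacian_plus_one_surj:
  fixes f :: "'v \<Rightarrow> 'k::conj_scalar"
  assumes f: "f \<in> l2"
  obtains u where "(u, \<lambda>x. f x - u x) \<in> l2_laplacian c"
proof -
  define T where "T u = (\<lambda>x. laplacian c u x + u x)" for u :: "'v \<Rightarrow> 'k"
  have T_l2: "T u \<in> l2" if "u \<in> delta_span" for u
    unfolding T_def using that by (intro l2_triangle) (simp_all add: l2_delta_span l2_laplacian_delta_span)
  have T_add: "(\<lambda>i. T u i + T v i) = T (\<lambda>i. u i + v i)" for u v
    by (simp add: T_def laplacian_add fun_eq_iff)
  have T_scale: "(\<lambda>i. a * T u i) = T (\<lambda>i. a * u i)" for a u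
    by (simp add: T_def laplacian_scale fun_eq_iff distrib_left)
  obtain Y g where Y: "\<And>n. Y n \<in> T ` delta_span" and g: "g \<in> l2" and lim: "vconverges l2_space Y g"
    and orth: "\<And>s. s \<in> T ` delta_span \<Longrightarrow> l2_inner (\<lambda>i. g i - f i) s = 0"
  proof (rule l2_projection[of "T ` delta_span" f])
    show "T ` delta_span \<noteq> {}" using delta_in_span[of undefined] by auto
    show "\<And>u v. u \<in> T ` delta_span \<Longrightarrow> v \<in> T ` delta_span \<Longrightarrow> (\<lambda>x. u x + v x) \<in> T ` delta_span"
      by (auto simp: T_add intro!: imageI delta_span_add)
    show "\<And>a u. u \<in> T ` delta_span \<Longrightarrow> (\<lambda>x. a * u x) \<in> T ` delta_span"
      by (auto simp: T_scale intro!: imageI delta_span_scale)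
  qed (use T_l2 f in auto)
  have h_l2: "(\<lambda>i. g i - f i) \<in> l2" by (intro l2_diff g f)
  have "laplacian c (\<lambda>i. g i - f i) v = - (g v - f v)" for v
  proof -
    have "0 = l2_inner (\<lambda>i. g i - f i) (T (delta v))" using orth[OF imageI[OF delta_in_span]] by simp
    also have "\<dots> = conj (laplacian c (\<lambda>i. g i - f i) v + (g v - f v))"
      unfolding T_def using h_l2
      by (simp add: l2_inner_add_right l2_laplacian_delta l2_delta inner_laplacian_delta l2_inner_delta conj_add)
    finally have "laplacian c (\<lambda>i. g i - f i) v + (g v - f v) = 0" by (metis conj_0 conj_conj)
    then show ?thesis by (simp only: eq_neg_iff_add_eq_0)
  qed
  from laplacian_eq_minus_imp_zero[OF h_l2 this] have "g = f" by (auto simp: fun_eq_iff)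
  have "\<forall>n. \<exists>u. u \<in> delta_span \<and> Y n = T u" using Y by auto
  from choice[OF this] obtain X where X: "\<And>n. X n \<in> delta_span" "\<And>n. Y n = T (X n)" by auto
  have X_l2: "X n \<in> l2" for n by (simp add: X l2_delta_span)
  have Y_l2: "Y n \<in> l2" for n by (simp add: X T_l2)
  have dist: "l2_norm (\<lambda>x. X m x - X n x) \<le> l2_norm (\<lambda>x. Y m x - f x) + l2_norm (\<lambda>x. Y n x - f x)" for m n
  proof -
    have "l2_norm (\<lambda>x. X m x - X n x) \<le> l2_norm (\<lambda>x. Y m x - Y n x)"
      using l2_norm_le_laplacian_plus_one[OF delta_span_diff[OF X(1) X(1)], of m n]
      by (simp add: X T_def laplacian_diff algebra_simps)
    also have "(\<lambda>x. Y m x - Y n x) = (\<lambda>x. (Y m x - f x) - (Y n x - f x))" by auto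
    also have "l2_norm \<dots> \<le> l2_norm (\<lambda>x. Y m x - f x) + l2_norm (\<lambda>x. Y n x - f x)"
      by (rule l2_norm_diff) (intro l2_diff Y_l2 f)+
    finally show ?thesis .
  qed
  have norms: "(\<lambda>n. l2_norm (\<lambda>i. Y n i - f i)) \<longlonglongrightarrow> 0"
    using lim by (simp add: vconverges_l2 \<open>g = f\<close>)
  have "\<exists>N. \<forall>m\<ge>N. \<forall>n\<ge>N. l2_norm (\<lambda>x. X m x - X n x) \<le> e" if "0 < e" for e
  proof -
    obtain N where N: "\<forall>n\<ge>N. l2_norm (\<lambda>i. Y n i - f i) < e / 2"
      using LIMSEQ_D[OF norms, of "e / 2"] \<open>0 < e\<close> by auto
    have "l2_norm (\<lambda>x. X m x - X n x) \<le> e" if "m \<ge> N" "n \<ge> N" for m n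
    proof -
      have "l2_norm (\<lambda>i. Y m i - f i) < e / 2" "l2_norm (\<lambda>i. Y n i - f i) < e / 2"
        using N that by blast+
      then show ?thesis using dist[of m n] by linarith
    qed
    then show ?thesis by blast
  qed
  from l2_complete[OF X_l2 this] obtain u where u: "u \<in> l2" and X_lim: "vconverges l2_space X u"
    by blast
  have "vconverges l2_space (\<lambda>n. laplacian c (X n)) (\<lambda>x. f x - u x)"
  proof -
    have le: "l2_norm (\<lambda>x. laplacian c (X n) x - (f x - u x))
        \<le> l2_norm (\<lambda>x. Y n x - f x) + l2_norm (\<lambda>x. X n x - u x)" for n
    proof -
      have eq: "(\<lambda>x. laplacian c (X n) x - (f x - u x)) = (\<lambda>x. (Y n x - f x) - (X n x - u x))"
        by (auto simp: X T_def)
      show ?thesis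
        unfolding eq by (rule l2_norm_diff) (intro l2_diff Y_l2 X_l2 f u)+
    qed
    have "(\<lambda>n. l2_norm (\<lambda>x. Y n x - f x) + l2_norm (\<lambda>x. X n x - u x)) \<longlonglongrightarrow> 0"
      using norms X_lim unfolding vconverges_l2 by (rule tendsto_add_zero)
    then show ?thesis
      unfolding vconverges_l2 by (rule tendsto_0_le[where K=1]) (simp add: le abs_of_nonneg)
  qed
  with X(1) X_lim have "\<exists>X W. (\<forall>n. (X n, W n) \<in> {(u, laplacian c u) | u. u \<in> delta_span})
      \<and> vconverges l2_space X u \<and> vconverges l2_space W (\<lambda>x. f x - u x)"
    by (intro exI[of _ X] exI[of _ "\<lambda>n. laplacian c (X n)"]) auto
  then have "(u, \<lambda>x. f x - u x) \<in> l2_laplacian c"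
    unfolding l2_laplacian_def op_closure_def using u l2_diff[OF f u] by blast
  then show thesis by (rule that)
qed

lemma l2_laplacianD:
  assumes "(u, w) \<in> l2_laplacian c"
  shows "u \<in> l2" "w \<in> l2" "w = laplacian c u"
proof -
  obtain X W where l2: "u \<in> l2" "w \<in> l2"
    and X: "\<And>n. (X n, W n) \<in> {(u, laplacian c u) | u. u \<in> delta_span}"
      "vconverges l2_space X u" "vconverges l2_space W w"
    using assms by (auto simp: l2_laplacian_def op_closure_def)
  have X_span: "X n \<in> delta_span" "W n = laplacian c (X n)" for n using X(1)[of n] by auto
  have "(\<lambda>n. X n v) \<longlonglongrightarrow> u v" for v
    by (intro l2_pointwise_tendsto X(2) l2) (simp add: X_span l2_delta_span)
  then have "(\<lambda>n. W n v) \<longlonglongrightarrow> laplacian c u v" for v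
    unfolding X_span(2) by (rule laplacian_tendsto)
  moreover have "(\<lambda>n. W n v) \<longlonglongrightarrow> w v" for v
    by (intro l2_pointwise_tendsto X(3) l2) (simp add: X_span l2_laplacian_delta_span)
  ultimately show "w = laplacian c u" using LIMSEQ_unique by blast
  show "u \<in> l2" "w \<in> l2" by fact+
qed

text \<open>
  Both operators are restrictions of the pointwise Laplacian to square-summable functions, and both
  become surjective after adding the identity. As \<open>\<Delta> + 1\<close> is injective on \<open>\<ell>\<^sup>2\<close>, they coincide with
  the operator \<open>u \<mapsto> \<Delta> u\<close> on all square-summable \<open>u\<close> with square-summable \<open>\<Delta> u\<close>.
\<close>

lemma l2_laplacian_eq_inclusion_product:
  "(l2_laplacian c :: ('v \<Rightarrow> 'k::conj_scalar, 'v \<Rightarrow> 'k) operator)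
     = inclusion c O op_adjoint l2_space (energy_space c) (inclusion c)"
    (is "?T = ?L")
proof -
  have L: "u \<in> l2 \<and> w \<in> l2 \<and> w = laplacian c u" if uw: "(u, w) \<in> ?L" for u w :: "'v \<Rightarrow> 'k"
  proof -
    obtain A where A: "(u, A) \<in> inclusion c"
      "(A, w) \<in> op_adjoint l2_space (energy_space c) (inclusion c)" using uw by blast
    obtain v where v: "v \<in> dom_energy c" "A = energy_class c v" "w = laplacian c v"
      using inclusion_adjointD[OF A(2)] by blast
    have "grad c u = grad c v"
      using inclusionD[OF A(1)] v(1,2) grad_rep by metis
    then obtain a where "\<And>x. v x = u x + a" using grad_eqD by blast
    then have "v = (\<lambda>x. u x + a)" by blast
    then have "w = laplacian c u" by (simp add: v(3) laplacian_add_const)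
    then show ?thesis using inclusionD[OF A(1)] A(2) by (auto simp: op_adjoint_def)
  qed
  have unique: "u = v" if "u \<in> l2" "v \<in> l2" "\<And>x. laplacian c u x + u x = laplacian c v x + v x"
    for u v :: "'v \<Rightarrow> 'k"
  proof
    fix x
    have "laplacian c (\<lambda>x. u x - v x) y = - (u y - v y)" for y
      using that(3)[of y] by (simp add: laplacian_diff algebra_simps)
    from laplacian_eq_minus_imp_zero[OF l2_diff[OF that(1,2)] this, of x] show "u x = v x" by simp
  qed
  show ?thesis
  proof (intro set_eqI iffI; clarify)
    fix u w :: "'v \<Rightarrow> 'k" assume "(u, w) \<in> ?T"
    note u = l2_laplacianD[OF this]
    have z: "(\<lambda>x. 0 :: 'k) \<in> dom_energy c"
      using dom_energy_scale[OF dom_energy_delta, of 0] by simp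
    obtain x where x: "(x, energy_class c x) \<in> inclusion c"
      and eq: "\<And>v. laplacian c (\<lambda>i. 0 - x i) v = x v - (w v + u v)"
      using inclusion_graph_projection[OF l2_triangle(1)[OF u(2,1)] z] by blast
    have lap: "laplacian c x v = w v + u v - x v" for v
      using eq[of v] unfolding laplacian_diff by (simp add: algebra_simps)
    have "x = u" using inclusionD(1)[OF x] u by (intro unique) (simp_all add: lap)
    then have "(u, energy_class c u) \<in> inclusion c" using x by simp
    with inclusion_adjointI[OF inclusionD(2)[OF this]] u show "(u, w) \<in> ?L" by blast
  next
    fix u w :: "'v \<Rightarrow> 'k" and A
    assume "(u, A) \<in> inclusion c"
      "(A, w) \<in> op_adjoint l2_space (energy_space c) (inclusion c)"
    then have "(u, w) \<in> ?L" by blast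
    then have u: "u \<in> l2" "w \<in> l2" "w = laplacian c u" using L by blast+
    obtain v where v: "(v, \<lambda>x. (w x + u x) - v x) \<in> ?T"
      using l2_laplacian_plus_one_surj[OF l2_triangle(1)[OF u(2,1)]] by blast
    note v' = l2_laplacianD[OF v]
    have "v = u" using v'(1) u(1) by (intro unique) (simp_all add: v'(3)[symmetric] u(3)[symmetric])
    then show "(u, w) \<in> ?T" using v by simp
  qed
qed

section \<open>Equality of the spectra outside zero\<close>

lemma spectrum_krein_l2:
  "spectrum (energy_space c :: ('k::conj_scalar, ('v \<Rightarrow> 'k) set) inner_space) (krein_laplacian c) \<union> {0}
     = spectrum (l2_space :: ('k, 'v \<Rightarrow> 'k) inner_space) (l2_laplacian c) \<union> {0}"
proof -
  define J :: "('v \<Rightarrow> 'k, ('v \<Rightarrow> 'k) set) operator" where "J = inclusion c"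
  let ?K = "energy_space c :: ('k, ('v \<Rightarrow> 'k) set) inner_space"
  define J' where "J' = op_adjoint l2_space ?K J"
  have J: "linear_operator l2_space ?K J" unfolding J_def by (rule linear_inclusion)
  have J': "linear_operator ?K l2_space J'"
    unfolding J'_def using J
    by (intro linear_operator_op_adjoint[OF l2_coordinates_l2_space l2_coordinates_energy_space])
       (simp add: linear_operator_def)
  have adj: "vinner ?K v y = l2_inner w x" if "(x, y) \<in> J" "(v, w) \<in> J'" for x y v w
    using that by (auto simp: J'_def op_adjoint_def)
  have adj': "l2_inner x w = vinner ?K y v" if "(x, y) \<in> J" "(v, w) \<in> J'" for x y v w
    using adj[OF that] linear_operatorD(1,2)[OF J that(1)] linear_operatorD(1,2)[OF J' that(2)]
      l2_coordinates.inner_commute[OF l2_coordinates_l2_space, of w x]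
      l2_coordinates.inner_commute[OF l2_coordinates_energy_space, of v y] by simp
  have "resolvent_set ?K (J' O J) - {0} \<subseteq> resolvent_set l2_space (J O J')"
  proof (rule resolvent_set_product_swap[OF l2_coordinates_l2_space l2_coordinates_energy_space J J' adj])
    fix f :: "'v \<Rightarrow> 'k" assume "f \<in> l2"
    then obtain u where "(u, \<lambda>x. f x - u x) \<in> J O J'"
      using l2_laplacian_plus_one_surj unfolding l2_laplacian_eq_inclusion_product J'_def J_def by blast
    then show "\<exists>x y b. (x, y) \<in> J \<and> (y, b) \<in> J' \<and> vadd l2_space b x = f"
      by (force simp: fun_eq_iff)
  qed
  moreover have "resolvent_set l2_space (J O J') - {0} \<subseteq> resolvent_set ?K (J' O J)"
  proof (rule resolvent_set_product_swap[OF l2_coordinates_energy_space l2_coordinates_l2_space J' J adj'])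
    fix Z assume "Z \<in> vecs ?K"
    then obtain z where z: "z \<in> dom_energy c" "Z = energy_class c z" by (auto simp: energy_space_vecs)
    obtain x where x: "(x, energy_class c x) \<in> J"
      and "\<And>v. laplacian c (\<lambda>i. z i - x i) v = x v - 0"
      using inclusion_graph_projection[OF l2_finite_support z(1), of "\<lambda>x. 0"] unfolding J_def by auto
    then have lap: "laplacian c (\<lambda>i. z i - x i) = x" by auto
    have x': "x \<in> l2" "x \<in> dom_energy c" using inclusionD x unfolding J_def by blast+
    have "(energy_class c (\<lambda>i. z i - x i), x) \<in> J'"
      using inclusion_adjointI[of "\<lambda>i. z i - x i"] z(1) x' unfolding J'_def J_def
      by (simp add: lap dom_energy_diff)
    moreover have "vadd ?K (energy_class c x) (energy_class c (\<lambda>i. z i - x i)) = Z"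
      using z x' by (simp add: vadd_energy_class dom_energy_diff)
    ultimately show "\<exists>y x b. (y, x) \<in> J' \<and> (x, b) \<in> J \<and> vadd ?K b y = Z"
      using x by blast
  qed
  ultimately show ?thesis
    unfolding spectrum_def krein_laplacian_def l2_laplacian_eq_inclusion_product J'_def J_def by blast
qed

end

theorem corollary3p31:
  fixes c :: "'v \<Rightarrow> 'v \<Rightarrow> real"
  assumes "network c"
  shows "spectrum (energy_space c :: ('k::conj_scalar, ('v \<Rightarrow> 'k) set) inner_space)
             (krein_laplacian c) \<union> {0}
       = spectrum (l2_space :: ('k, 'v \<Rightarrow> 'k) inner_space) (l2_laplacian c) \<union> {0}"
  using assms by (rule network.spectrum_krein_l2)

end
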